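(* Let $\mathcal A$ be a C*-subalgebra of $\mathrm{Mat}(n,\mathbb C)$ with state space $\mathcal S$, and let $\omega\in\{\mathrm I,\mathrm{rI}\}$. The convergence $C^\omega$ is an L*-convergence on $\mathcal S$. In particular $C(\mathcal T^\omega)=C^\omega$. For every $X\subset\mathcal S$ the sequential closure of $X$ with respect to $C^\omega$ equals the $\omega$-closure $\mathrm{cl}^\omega(X):=\{\rho\in\mathcal S\mid \inf_{\tau\in X}S^\omega(\rho,\tau)=0\}$, that is, $$\mathrm{cl}^\omega(X)=\{\rho\in\mathcal S\mid\lim_{i\to\infty}S^\omega(\rho,\rho_i)=0\text{ for a sequence }(\rho_i)_{i\in\mathbb N}\subset X\}=\{\rho\in\mathcal S\mid\inf_{i\in\mathbb N}S^\omega(\rho,\rho_i)=0\text{ for a sequence }(\rho_i)_{i\in\mathbb N}\subset X\}.$$ Moreover: 1. The L*-convergence $C^\omega$ has unique limits. We have $C^\omega\subset C^{\|\cdot\|}$ and $\mathcal T^\omega\supset\mathcal T^{\|\cdot\|}$. In particular $\mathcal T^\omega$ is a Hausdorff topology. 2. For every $\rho\in\mathcal S$ the map $\mathcal S\to[0,\infty]$, $\sigma\mapsto S^\omega(\rho,\sigma)$ is continuous for $C^\omega$ and $C^{\mathrm c}$, and continuous for $\mathcal T^\omega$ and $\mathcal T^{\mathrm c}$. For each $\rho\in\mathcal S$ and $\epsilon\in(0,\infty]$ the open $\omega$-disk $V^\omega(\rho,\epsilon)$ is $\mathcal T^\omega$ open and the closed $\omega$-disk $W^\omega(\rho,\epsilon)$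 is $\mathcal T^\omega$ closed. The open $\omega$-disks $\{V^\omega(\rho,\epsilon)\mid\epsilon\in(0,\infty]\}$ are a base for $(\mathcal S,\mathcal T^\omega)$ at $\rho$. In particular $\mathcal T^\omega$ is first countable, and for any subset $X\subset\mathcal S$ we have $\mathcal T^\omega|_X=\mathcal T(C^\omega|_X)$. For any subset $X\subset\mathcal S$ the sequential closure $\mathrm{cl}^\omega(X)$ is the $\mathcal T^\omega$ closure of $X$. 3. Every term in the partition $\mathcal S=\bigcup_{F}\mathrm{ri}(F)$, $F$ running over the non-empty faces of the convex set $\mathcal S$, is a $\mathcal T^{\mathrm I}$ connected component of $\mathcal S$. For all faces $F$ of $\mathcal S$ we have $C^{\mathrm I}|_{\mathrm{ri}(F)}=C^{\|\cdot\|}|_{\mathrm{ri}(F)}$ and $\mathcal T^{\mathrm I}|_{\mathrm{ri}(F)}=\mathcal T^{\|\cdot\|}|_{\mathrm{ri}(F)}$. 4. We have $\mathcal T^{\|\cdot\|}\subset\mathcal T^{\mathrm{rI}}\subset\mathcal T^{\mathrm I}$ and $C^{\|\cdot\|}\supset C^{\mathrm{rI}}\supset C^{\mathrm I}$. 5. The $\mathcal T^{\mathrm{rI}}$ closure of $\mathrm{ri}(\mathcal S)$ is $\mathcal S$, and the topological space $(\mathcal S,\mathcal T^{\mathrm{rI}})$ is connected.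
   Context: A C*-subalgebra $\mathcal A$ of $\mathrm{Mat}(n,\mathbb C)$ is a (non-zero) complex subalgebra closed under conjugate transpose $a\mapsto a^*$; its identity need not be $\mathbb 1_n$. State space: $\mathcal S=\{\rho\in\mathcal A\mid\rho\succeq0,\ \mathrm{tr}(\rho)=1\}$, a compact convex set. Relative entropy: $S(\rho,\sigma)=\mathrm{tr}\,\rho(\log\rho-\log\sigma)$ if $\mathrm{Im}(\rho)\subset\mathrm{Im}(\sigma)$ (logarithms taken on the respective images and extended by $0$ on the kernels), otherwise $S(\rho,\sigma)=+\infty$. Put $S^{\mathrm I}(\rho,\sigma):=S(\sigma,\rho)$ and $S^{\mathrm{rI}}(\rho,\sigma):=S(\rho,\sigma)$. A convergence on a set $X$ is a relation $C\subset X^{\mathbb N}\times X$; write $x_n\xrightarrow{C}x$ for $((x_n),x)\in C$. It is an L*-convergence if (a) constant sequences converge to their value; (b) if $x_n\xrightarrow{C}x$ then every subsequence $C$-converges to $x$; (c) if $x_n\not\xrightarrow{C}x$ then there is a subsequence $(y_n)$ of $(x_n)$ no subsequence of which $C$-converges to $x$. $C$ has unique limits if $x_n\xrightarrow{C}x$ and $x_n\xrightarrow{C}y$ imply $x=y$. The topology $\mathcal T(C)$ consists of all $U\subset X$ such that $x\in U$ and $x_n\xrightarrow{C}x$ imply $x_n\in U$ for all large $n$. For a topology $\mathcal T$ on $X$, $C(\mathcal T)$ is the usual convergence of sequences in $\mathcal T$. The sequential closure of $Y\subset X$ with respect to $C$ is $\{x\in X\mid x_n\xrightarrow{C}x\text{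 for some sequence }(x_n)\subset Y\}$. A map $f:X\to X'$ is continuous for convergences $C,C'$ if $x_n\xrightarrow{C}x$ implies $f(x_n)\xrightarrow{C'}f(x)$. For $B\subset X$, $\mathcal T|_B$ is the subspace topology and $C|_B:=C\cap(B^{\mathbb N}\times B)$. On $\mathcal S$: $\rho_i\xrightarrow{C^\omega}\rho$ iff $\lim_{i\to\infty}S^\omega(\rho,\rho_i)=0$, and $\mathcal T^\omega:=\mathcal T(C^\omega)$; $C^{\|\cdot\|}$ and $\mathcal T^{\|\cdot\|}$ denote norm convergence and norm topology on $\mathcal S$. $\mathcal T^{\mathrm c}$ is the usual compact topology of $[0,\infty]$ (one-point compactification of $[0,\infty)$) and $C^{\mathrm c}=C(\mathcal T^{\mathrm c})$. Disks: $V^\omega(\rho,\epsilon)=\{\sigma\in\mathcal S\mid S^\omega(\rho,\sigma)<\epsilon\}$, $W^\omega(\rho,\epsilon)=\{\sigma\in\mathcal S\mid S^\omega(\rho,\sigma)\le\epsilon\}$. A base at a point $x$ is a family of open sets containing $x$ such that every open set containing $x$ includes a member of the family. A face of a convex set $K$ is a convex subset $F\subset K$ such that whenever $x,y\in K$ and the open segment $]x,y[$ meets $F$, then $[x,y]\subset F$. The relative interior $\mathrm{ri}(F)$ is the interior of $F$ in its affine hull. *)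

theory Defs
  imports "HOL-Analysis.Analysis"
begin

type_synonym 'a convergence = "((nat \<Rightarrow> 'a) \<times> 'a) set"

definition conv_on :: "'a set \<Rightarrow> 'a convergence \<Rightarrow> bool" where
  "conv_on X C \<longleftrightarrow> C \<subseteq> (UNIV \<rightarrow> X) \<times> X"

definition Lstar_conv :: "'a set \<Rightarrow> 'a convergence \<Rightarrow> bool" where
  "Lstar_conv X C \<longleftrightarrow>
     conv_on X C \<and>
     (\<forall>x\<in>X. ((\<lambda>_. x), x) \<in> C) \<and>
     (\<forall>xs x. (xs, x) \<in> C \<longrightarrow> (\<forall>r::nat \<Rightarrow> nat. strict_mono r \<longrightarrow> (xs \<circ> r, x) \<in> C)) \<and>
     (\<forall>xs\<in>UNIV \<rightarrow> X. \<forall>x\<in>X. (xs, x) \<notin> C \<longrightarrow>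
        (\<exists>r::nat \<Rightarrow> nat. strict_mono r \<and>
           (\<forall>s::nat \<Rightarrow> nat. strict_mono s \<longrightarrow> (xs \<circ> r \<circ> s, x) \<notin> C)))"

definition unique_limits :: "'a convergence \<Rightarrow> bool" where
  "unique_limits C \<longleftrightarrow> (\<forall>xs x y. (xs, x) \<in> C \<longrightarrow> (xs, y) \<in> C \<longrightarrow> x = y)"

definition conv_openset :: "'a set \<Rightarrow> 'a convergence \<Rightarrow> 'a set \<Rightarrow> bool" where
  "conv_openset X C U \<longleftrightarrow>
     U \<subseteq> X \<and> (\<forall>xs x. x \<in> U \<longrightarrow> (xs, x) \<in> C \<longrightarrow> (\<forall>\<^sub>F i in sequentially. xs i \<in> U))"

definition topology_of_conv :: "'a set \<Rightarrow> 'a convergence \<Rightarrow> 'a topology" where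
  "topology_of_conv X C = topology (conv_openset X C)"

lemma istopology_conv_openset: "istopology (conv_openset X C)"
  unfolding istopology_def
proof (intro conjI allI impI)
  fix U V assume "conv_openset X C U" "conv_openset X C V"
  then show "conv_openset X C (U \<inter> V)"
    unfolding conv_openset_def by (auto intro: eventually_conj)
next
  fix \<K> assume "\<forall>K\<in>\<K>. conv_openset X C K"
  then show "conv_openset X C (\<Union>\<K>)"
    unfolding conv_openset_def by (blast intro: eventually_mono)
qed

lemma openin_topology_of_conv: "openin (topology_of_conv X C) = conv_openset X C"
  by (simp add: topology_of_conv_def topology_inverse' istopology_conv_openset)

lemma topspace_topology_of_conv:
  assumes "conv_on X C" shows "topspace (topology_of_conv X C) = X"
proof
  show "topspace (topology_of_conv X C) \<subseteq> X"
    using openin_topspace[of "topology_of_conv X C"]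
    by (simp add: openin_topology_of_conv conv_openset_def)
  have "conv_openset X C X"
    using assms unfolding conv_openset_def conv_on_def
    by (auto intro!: always_eventually)
  then show "X \<subseteq> topspace (topology_of_conv X C)"
    by (metis openin_topology_of_conv openin_subset)
qed

definition conv_of_topology :: "'a topology \<Rightarrow> 'a convergence" where
  "conv_of_topology T =
     {(xs, x). xs \<in> UNIV \<rightarrow> topspace T \<and> limitin T xs x sequentially}"

definition conv_restrict :: "'a convergence \<Rightarrow> 'a set \<Rightarrow> 'a convergence" where
  "conv_restrict C B = C \<inter> ((UNIV \<rightarrow> B) \<times> B)"

definition seq_closure :: "'a set \<Rightarrow> 'a convergence \<Rightarrow> 'a set \<Rightarrow> 'a set" where
  "seq_closure X C Y = {x \<in> X. \<exists>xs \<in> UNIV \<rightarrow> Y. (xs, x) \<in> C}"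

definition conv_continuous ::
  "'a set \<Rightarrow> 'a convergence \<Rightarrow> 'b set \<Rightarrow> 'b convergence \<Rightarrow> ('a \<Rightarrow> 'b) \<Rightarrow> bool"
  where
  "conv_continuous X C X' C' f \<longleftrightarrow>
     f \<in> X \<rightarrow> X' \<and> (\<forall>xs x. (xs, x) \<in> C \<longrightarrow> (f \<circ> xs, f x) \<in> C')"

definition topology_le :: "'a topology \<Rightarrow> 'a topology \<Rightarrow> bool" where
  "topology_le T T' \<longleftrightarrow> {U. openin T U} \<subseteq> {U. openin T' U}"

definition base_at :: "'a topology \<Rightarrow> 'a \<Rightarrow> 'a set set \<Rightarrow> bool" where
  "base_at T x \<B> \<longleftrightarrow>
     (\<forall>B\<in>\<B>. openin T B \<and> x \<in> B) \<and>
     (\<forall>U. openin T U \<and> x \<in> U \<longrightarrow> (\<exists>B\<in>\<B>. B \<subseteq> U))"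

definition mat_adjoint :: "complex^'n^'n \<Rightarrow> complex^'n^'n" where
  "mat_adjoint a = (\<chi> i j. cnj (a $ j $ i))"

text \<open>The identity of the algebra, if different from \<open>mat 1\<close>, is not part of the structure.\<close>

definition cstar_subalgebra :: "(complex^'n^'n) set \<Rightarrow> bool" where
  "cstar_subalgebra A \<longleftrightarrow>
     (\<exists>a\<in>A. a \<noteq> 0) \<and>
     (\<forall>a\<in>A. \<forall>b\<in>A. a + b \<in> A) \<and>
     (\<forall>c. \<forall>a\<in>A. (\<chi> i j. c * a $ i $ j) \<in> A) \<and>
     (\<forall>a\<in>A. \<forall>b\<in>A. a ** b \<in> A) \<and>
     (\<forall>a\<in>A. mat_adjoint a \<in> A)"

text \<open>On \<open>complex^'n\<close> the library inner product \<open>v \<bullet> w\<close> is the real part of the standard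
  hermitian form; for a hermitian matrix the form \<open>\<langle>v, a v\<rangle>\<close> is real.\<close>

definition psd :: "complex^'n^'n \<Rightarrow> bool" where
  "psd a \<longleftrightarrow> mat_adjoint a = a \<and> (\<forall>v. 0 \<le> v \<bullet> (a *v v))"

definition state_space :: "(complex^'n^'n) set \<Rightarrow> (complex^'n^'n) set" where
  "state_space A = {\<rho> \<in> A. psd \<rho> \<and> trace \<rho> = 1}"

definition eigenspace :: "complex^'n^'n \<Rightarrow> real \<Rightarrow> (complex^'n) set" where
  "eigenspace a l = {v. a *v v = l *\<^sub>R v}"

text \<open>Matrix of the orthogonal projection onto the eigenspace for \<open>l\<close>: the nearest point of a
  complex subspace is the image under the (complex-linear) orthogonal projection.\<close>

definition eigenprojection :: "complex^'n^'n \<Rightarrow> real \<Rightarrow> complex^'n^'n" where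
  "eigenprojection a l = matrix (closest_point (eigenspace a l))"

text \<open>Spectral calculus for positive semidefinite \<open>a\<close>: the logarithm on the image of \<open>a\<close> (the span
  of the eigenspaces for the eigenvalues \<open>l > 0\<close>), extended by \<open>0\<close> on the kernel.\<close>

definition mat_log :: "complex^'n^'n \<Rightarrow> complex^'n^'n" where
  "mat_log a =
     (\<Sum>l \<in> {l. 0 < l \<and> eigenspace a l \<noteq> {0}}. ln l *\<^sub>R eigenprojection a l)"

text \<open>The trace below is real for states, so taking \<open>Re\<close> only changes the type.\<close>

definition rel_entropy :: "complex^'n^'n \<Rightarrow> complex^'n^'n \<Rightarrow> ereal" where
  "rel_entropy \<rho> \<sigma> =
     (if range ((*v) \<rho>) \<subseteq> range ((*v) \<sigma>)
      then ereal (Re (trace (\<rho> ** (mat_log \<rho> - mat_log \<sigma>)))) else \<infinity>)"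

datatype info_kind = kind_I | kind_rI

fun info_div :: "info_kind \<Rightarrow> complex^'n^'n \<Rightarrow> complex^'n^'n \<Rightarrow> ereal" where
  "info_div kind_I \<rho> \<sigma> = rel_entropy \<sigma> \<rho>"
| "info_div kind_rI \<rho> \<sigma> = rel_entropy \<rho> \<sigma>"

definition info_conv ::
  "(complex^'n^'n) set \<Rightarrow> info_kind \<Rightarrow> (complex^'n^'n) convergence" where
  "info_conv A \<omega> =
     {(\<rho>s, \<rho>). \<rho>s \<in> UNIV \<rightarrow> state_space A \<and> \<rho> \<in> state_space A \<and>
               (\<lambda>i. info_div \<omega> \<rho> (\<rho>s i)) \<longlonglongrightarrow> 0}"

definition info_topology :: "(complex^'n^'n) set \<Rightarrow> info_kind \<Rightarrow> (complex^'n^'n) topology" where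
  "info_topology A \<omega> = topology_of_conv (state_space A) (info_conv A \<omega>)"

text \<open>The norm of \<open>complex^'n^'n\<close> is the Frobenius norm; all norms induce the same convergence.\<close>

definition norm_conv ::
  "(complex^'n^'n) set \<Rightarrow> (complex^'n^'n) convergence" where
  "norm_conv A =
     {(\<rho>s, \<rho>). \<rho>s \<in> UNIV \<rightarrow> state_space A \<and> \<rho> \<in> state_space A \<and> \<rho>s \<longlonglongrightarrow> \<rho>}"

definition norm_topology :: "(complex^'n^'n) set \<Rightarrow> (complex^'n^'n) topology" where
  "norm_topology A = top_of_set (state_space A)"

text \<open>\<open>[0,\<infinity>]\<close> with the order topology, which is the one-point compactification of \<open>[0,\<infinity>)\<close>.\<close>

definition ext_topology :: "ereal topology" where
  "ext_topology = top_of_set {0..\<infinity>}"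

definition open_disk ::
  "(complex^'n^'n) set \<Rightarrow> info_kind \<Rightarrow> complex^'n^'n \<Rightarrow> ereal \<Rightarrow> (complex^'n^'n) set" where
  "open_disk A \<omega> \<rho> \<epsilon> = {\<sigma> \<in> state_space A. info_div \<omega> \<rho> \<sigma> < \<epsilon>}"

definition closed_disk ::
  "(complex^'n^'n) set \<Rightarrow> info_kind \<Rightarrow> complex^'n^'n \<Rightarrow> ereal \<Rightarrow> (complex^'n^'n) set" where
  "closed_disk A \<omega> \<rho> \<epsilon> = {\<sigma> \<in> state_space A. info_div \<omega> \<rho> \<sigma> \<le> \<epsilon>}"

text \<open>For \<open>X = {}\<close> the infimum is \<open>\<infinity>\<close>, so the closure is empty.\<close>

definition info_closure ::
  "(complex^'n^'n) set \<Rightarrow> info_kind \<Rightarrow> (complex^'n^'n) set \<Rightarrow> (complex^'n^'n) set" where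
  "info_closure A \<omega> X = {\<rho> \<in> state_space A. (INF \<tau>\<in>X. info_div \<omega> \<rho> \<tau>) = 0}"

end

theory Submission
  imports Defs
begin

text \<open>
  For a state \<open>\<rho>\<close> and a hermitian matrix \<open>\<sigma>\<close> the numbers \<open>tr (\<rho> E)\<close>, with \<open>E\<close> a spectral projection
  of \<open>\<sigma>\<close>, are the weights of a measure on the spectrum of \<open>\<sigma>\<close>; by Weierstrass approximation its
  integrals of continuous functions depend continuously on \<open>\<sigma>\<close>. Only the logarithm near \<open>0\<close>
  escapes this, and there domination \<open>\<rho> \<le> c \<sigma>\<close>, which holds for some \<open>c\<close> when
  \<open>ker \<sigma> \<subseteq> ker \<rho>\<close>, compares the contribution for \<open>\<rho>\<close> with that for \<open>\<sigma>\<close>. This yields continuity of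
  \<open>S\<^sup>\<omega>(\<rho>, \<cdot>)\<close> along \<open>C\<^sup>\<omega>\<close>, from which the topological statements follow formally; norm
  convergence comes from the quadratic refinement of Klein's inequality. For the faces, \<open>\<sigma>\<close> and \<open>\<rho>\<close>
  lie in the relative interior of the same face iff they have the same kernel, and \<open>C\<^sup>I\<close>-convergence
  makes kernels eventually constant.
\<close>

subsection \<open>Complex matrices as a Euclidean space\<close>

text \<open>The obstacle is that S(rho, .) is in general not norm continuous at a state with a
  kernel: if x_i tends to sigma in norm, the eigenvalues of x_i that tend to 0 may contribute any
  amount to tr(rho ln x_i). The hypothesis S(sigma, x_i) -> 0 amounts to the disappearance of this
  contribution when it is weighted by sigma. The constant c in rho <= c sigma does not depend on i,
  so the contribution weighted by rho disappears too. If no such c exists, S(rho, x_i) tends to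
  infinity, the value at the limit. In the first argument the difficulty is absent: S(x_i, rho) is a
  continuous function of x_i as long as it is finite, and only the kernel condition can fail. The
  inclusion of C^I in C^rI needs a second kind of domination, of sigma by 2 x_i. The trace is
  replaced throughout by the real Frobenius inner product, so that spectral weights are inner
  products with orthogonal projections.\<close>

lemma bounded_bilinear_matrix_mult:
  "bounded_bilinear ((**) :: complex^'n^'n \<Rightarrow> complex^'n^'n \<Rightarrow> complex^'n^'n)"
proof -
  have "bilinear ((**) :: complex^'n^'n \<Rightarrow> complex^'n^'n \<Rightarrow> complex^'n^'n)"
    unfolding bilinear_def
    by (auto intro!: linearI
        simp: matrix_matrix_mult_def vec_eq_iff algebra_simps sum.distrib scaleR_sum_right)
  then show ?thesis by (simp add: bilinear_conv_bounded_bilinear)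
qed

lemma bounded_bilinear_matrix_vector_mult:
  "bounded_bilinear ((*v) :: complex^'n^'n \<Rightarrow> complex^'n \<Rightarrow> complex^'n)"
proof -
  have "bilinear ((*v) :: complex^'n^'n \<Rightarrow> complex^'n \<Rightarrow> complex^'n)"
    unfolding bilinear_def
    by (auto intro!: linearI
        simp: matrix_vector_mult_def vec_eq_iff algebra_simps sum.distrib scaleR_sum_right)
  then show ?thesis by (simp add: bilinear_conv_bounded_bilinear)
qed

interpretation mm: bounded_bilinear "(**) :: complex^'n^'n \<Rightarrow> complex^'n^'n \<Rightarrow> complex^'n^'n"
  by (rule bounded_bilinear_matrix_mult)

interpretation mv: bounded_bilinear "(*v) :: complex^'n^'n \<Rightarrow> complex^'n \<Rightarrow> complex^'n"
  by (rule bounded_bilinear_matrix_vector_mult)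

lemma mat_adjoint_adjoint [simp]: "mat_adjoint (mat_adjoint a) = a"
  by (simp add: mat_adjoint_def vec_eq_iff)

lemma linear_mat_adjoint: "linear mat_adjoint"
  by (auto intro!: linearI simp: mat_adjoint_def vec_eq_iff)

lemmas mat_adjoint_linear =
  linear_add[OF linear_mat_adjoint] linear_diff[OF linear_mat_adjoint]
  linear_scale[OF linear_mat_adjoint] linear_sum[OF linear_mat_adjoint]
  linear_0[OF linear_mat_adjoint]

lemma mat_adjoint_mult: "mat_adjoint (a ** b) = mat_adjoint b ** mat_adjoint a"
  by (simp add: mat_adjoint_def matrix_matrix_mult_def vec_eq_iff mult.commute)

lemma mat_adjoint_mat_1 [simp]: "mat_adjoint (mat 1) = mat 1"
  by (simp add: mat_adjoint_def mat_def vec_eq_iff)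

lemma inner_complex_mult_left: "(c * x) \<bullet> y = x \<bullet> (cnj c * y)" for c x y :: complex
  by (simp add: inner_complex_def algebra_simps)

lemma inner_matrix_vector_mult: "(a *v x) \<bullet> y = x \<bullet> (mat_adjoint a *v y)"
  for a :: "complex^'n^'n"
proof -
  have "(a *v x) \<bullet> y = (\<Sum>i\<in>UNIV. \<Sum>j\<in>UNIV. x $ j \<bullet> (cnj (a $ i $ j) * y $ i))"
    by (simp add: inner_vec_def matrix_vector_mult_def inner_sum_left inner_complex_mult_left)
  also have "\<dots> = x \<bullet> (mat_adjoint a *v y)"
    by (subst sum.swap)
      (simp add: inner_vec_def matrix_vector_mult_def inner_sum_right mat_adjoint_def)
  finally show ?thesis .
qed

text \<open>Left multiplication acts on each column separately, so this split transfers the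
  adjunction from vectors to matrices.\<close>

lemma inner_eq_sum_column:
  "a \<bullet> b = (\<Sum>j\<in>UNIV. column j a \<bullet> column j b)" for a b :: "complex^'n^'n"
  by (simp add: inner_vec_def column_def) (rule sum.swap)

lemma column_matrix_mult: "column j (a ** b) = a *v column j b" for a :: "complex^'n^'n"
  by (simp add: column_def matrix_matrix_mult_def matrix_vector_mult_def vec_eq_iff)

lemma inner_matrix_mult_left: "(a ** b) \<bullet> c = b \<bullet> (mat_adjoint a ** c)"
  for a b c :: "complex^'n^'n"
  by (simp add: inner_eq_sum_column column_matrix_mult inner_matrix_vector_mult)

lemma inner_mat_adjoint: "mat_adjoint a \<bullet> mat_adjoint b = a \<bullet> b"
  for a b :: "complex^'n^'n"
proof -
  have "mat_adjoint a \<bullet> mat_adjoint b = (\<Sum>i\<in>UNIV. \<Sum>j\<in>UNIV. a $ j $ i \<bullet> b $ j $ i)"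
    by (simp add: inner_vec_def mat_adjoint_def inner_complex_def)
  also have "\<dots> = (\<Sum>j\<in>UNIV. \<Sum>i\<in>UNIV. a $ j $ i \<bullet> b $ j $ i)" by (rule sum.swap)
  finally show ?thesis by (simp add: inner_vec_def)
qed

lemma inner_matrix_mult_right: "(a ** b) \<bullet> c = a \<bullet> (c ** mat_adjoint b)"
  for a b c :: "complex^'n^'n"
proof -
  have "(a ** b) \<bullet> c = (mat_adjoint b ** mat_adjoint a) \<bullet> mat_adjoint c"
    by (simp add: inner_mat_adjoint flip: mat_adjoint_mult)
  also have "\<dots> = mat_adjoint a \<bullet> mat_adjoint (c ** mat_adjoint b)"
    by (simp add: inner_matrix_mult_left mat_adjoint_mult)
  finally show ?thesis by (simp add: inner_mat_adjoint)
qed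

text \<open>The bridge from traces to the Euclidean structure: for hermitian \<open>a\<close> the
  real part of tr(a b) is an inner product.\<close>

lemma Re_trace_mult: "Re (trace (a ** b)) = mat_adjoint a \<bullet> b"
  by (simp add: trace_def matrix_matrix_mult_def inner_vec_def mat_adjoint_def inner_complex_def)
    (rule sum.swap)

lemma Re_trace: "Re (trace a) = mat 1 \<bullet> a"
  using Re_trace_mult[of "mat 1" a] by simp

text \<open>Cauchy-Schwarz in each row: the Frobenius norm dominates the operator norm.\<close>

lemma norm_matrix_vector_mult_le: "norm (a *v x) \<le> norm a * norm x" for a :: "complex^'n^'n"
proof -
  have row: "norm ((a *v x) $ i) \<le> norm (a $ i) * norm x" for i
  proof -
    have "norm ((a *v x) $ i) \<le> (\<Sum>j\<in>UNIV. \<bar>norm (a $ i $ j)\<bar> * \<bar>norm (x $ j)\<bar>)"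
      by (simp add: matrix_vector_mult_def flip: norm_mult) (rule norm_sum)
    also have "\<dots> \<le> norm (a $ i) * norm x"
      unfolding norm_vec_def by (rule L2_set_mult_ineq)
    finally show ?thesis .
  qed
  have "norm (a *v x) \<le> L2_set (\<lambda>i. norm (a $ i) * norm x) UNIV"
    unfolding norm_vec_def[of "a *v x"] by (rule L2_set_mono) (use row in auto)
  also have "\<dots> = norm a * norm x"
    unfolding norm_vec_def[of a] by (simp add: L2_set_left_distrib)
  finally show ?thesis .
qed

subsection \<open>The spectral theorem\<close>

lemma subspace_eigenspace: "subspace (eigenspace a l)"
  by (auto simp: subspace_def eigenspace_def mv.add_right mv.scaleR_right mv.zero_right algebra_simps)

section \<open>Orthogonal projection onto a subspace\<close>

context
  fixes E :: "'a::euclidean_space set"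
  assumes E: "subspace E"
begin

lemma closest_point_subspace_in: "closest_point E x \<in> E"
  using E by (intro closest_point_in_set closed_subspace) (auto dest: subspace_0)

text \<open>The obtuse-angle inequality for convex sets, tested at the closest point plus
  \<open>y\<close> and minus \<open>y\<close>, gives both signs.\<close>

lemma closest_point_subspace_orthogonal:
  assumes "y \<in> E" shows "(x - closest_point E x) \<bullet> y = 0"
proof -
  have "(x - closest_point E x) \<bullet> (z - closest_point E x) \<le> 0" if "z \<in> E" for z
    using closest_point_dot[OF subspace_imp_convex[OF E] closed_subspace[OF E] that] .
  from this[of "closest_point E x + y"] this[of "closest_point E x - y"]
  show ?thesis
    using assms closest_point_subspace_in[of x] E by (simp add: subspace_add subspace_diff)
qed

lemma closest_point_subspace_eqI:
  assumes "y \<in> E" "\<And>z. z \<in> E \<Longrightarrow> (x - y) \<bullet> z = 0"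
  shows "closest_point E x = y"
proof -
  let ?d = "closest_point E x - y"
  have "?d \<in> E" using assms closest_point_subspace_in E by (simp add: subspace_diff)
  then have "(x - y) \<bullet> ?d - (x - closest_point E x) \<bullet> ?d = 0"
    using assms(2) closest_point_subspace_orthogonal by simp
  then have "?d \<bullet> ?d = 0" by (simp flip: inner_diff_left)
  then show ?thesis by simp
qed

end

text \<open>\<open>matrix\<close> represents only complex linear maps, whereas closest points refer
  to the real inner product. Complex linearity holds because the eigenspace is closed under complex
  scalars: moving \<open>c\<close> across the inner product as \<open>cnj c\<close> keeps the test
  vector in the eigenspace.\<close>

lemma eigenprojection_mult: "eigenprojection a l *v x = closest_point (eigenspace a l) x"
proof -
  let ?E = "eigenspace a l"
  note E = subspace_eigenspace[of a l]
  have scale: "c *s y \<in> ?E" if "y \<in> ?E" for c y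
  proof -
    have "a *v (c *s y) = c *s (a *v y)" by (simp add: vec.scale)
    also have "\<dots> = l *\<^sub>R (c *s y)"
      using that by (simp add: eigenspace_def vec_eq_iff)
    finally show ?thesis by (simp add: eigenspace_def)
  qed
  have adj: "(c *s y) \<bullet> z = y \<bullet> (cnj c *s z)" for c and y z :: "complex^'a"
    by (simp add: inner_vec_def inner_complex_mult_left)
  have "Vector_Spaces.linear (*s) (*s) (closest_point ?E)"
    unfolding Vector_Spaces.linear_iff
  proof (intro conjI allI)
    show "vector_space ((*s) :: complex \<Rightarrow> complex^'a \<Rightarrow> _)" by unfold_locales
    show "vector_space ((*s) :: complex \<Rightarrow> complex^'a \<Rightarrow> _)" by unfold_locales
    fix x y c
    show "closest_point ?E (x + y) = closest_point ?E x + closest_point ?E y"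
      using closest_point_subspace_in[OF E] closest_point_subspace_orthogonal[OF E]
      by (intro closest_point_subspace_eqI[OF E])
        (auto simp: subspace_add[OF E] add_diff_add inner_add_left)
    show "closest_point ?E (c *s x) = c *s closest_point ?E x"
      using closest_point_subspace_in[OF E] closest_point_subspace_orthogonal[OF E]
      by (intro closest_point_subspace_eqI[OF E])
        (auto simp: scale adj simp flip: vector_ssub_ldistrib)
  qed
  then show ?thesis unfolding eigenprojection_def by (rule matrix_works)
qed

definition eigvals :: "complex^'n^'n \<Rightarrow> real set" where
  "eigvals a = {l. eigenspace a l \<noteq> {0}}"

lemma zero_in_eigenspace [simp]: "0 \<in> eigenspace a l"
  using subspace_eigenspace by (rule subspace_0)

lemma eigvalsI: "v \<in> eigenspace a l \<Longrightarrow> v \<noteq> 0 \<Longrightarrow> l \<in> eigvals a"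
  by (auto simp: eigvals_def)

lemma eigvalsE:
  assumes "l \<in> eigvals a"
  obtains v where "v \<noteq> 0" "a *v v = l *\<^sub>R v"
proof -
  have "\<exists>v. v \<in> eigenspace a l \<and> v \<noteq> 0"
    using assms zero_in_eigenspace[of a l] by (auto simp: eigvals_def simp del: zero_in_eigenspace)
  with that show thesis by (auto simp: eigenspace_def)
qed

lemma eigenprojection_in: "eigenprojection a l *v x \<in> eigenspace a l"
  by (simp add: eigenprojection_mult closest_point_subspace_in subspace_eigenspace)

lemma eigenprojection_orthogonal:
  "y \<in> eigenspace a l \<Longrightarrow> (x - eigenprojection a l *v x) \<bullet> y = 0"
  by (simp add: eigenprojection_mult closest_point_subspace_orthogonal subspace_eigenspace)

lemma eigenprojection_fix: "x \<in> eigenspace a l \<Longrightarrow> eigenprojection a l *v x = x"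
  by (simp add: eigenprojection_mult closest_point_self)

lemma matrix_eqI_inner:
  fixes a b :: "complex^'n^'n"
  assumes "\<And>x y. (a *v x) \<bullet> y = (b *v x) \<bullet> y" shows "a = b"
proof -
  have "a *v x = b *v x" for x by (rule vector_eq_rdot[THEN iffD1]) (use assms in simp)
  then show ?thesis by (simp add: matrix_eq)
qed

text \<open>Orthogonality turns both sides into the inner product of the two projected
  vectors.\<close>

lemma eigenprojection_hermitian [simp]: "mat_adjoint (eigenprojection a l) = eigenprojection a l"
proof (rule matrix_eqI_inner)
  fix x y
  let ?P = "eigenprojection a l"
  have "x \<bullet> (?P *v y) = (?P *v x) \<bullet> (?P *v y)"
    using eigenprojection_orthogonal[OF eigenprojection_in, of x a l y] by (simp add: inner_diff_left)
  moreover have "y \<bullet> (?P *v x) = (?P *v y) \<bullet> (?P *v x)"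
    using eigenprojection_orthogonal[OF eigenprojection_in, of y a l x] by (simp add: inner_diff_left)
  moreover have "(mat_adjoint ?P *v x) \<bullet> y = x \<bullet> (?P *v y)"
    by (simp add: inner_matrix_vector_mult)
  ultimately show "(mat_adjoint ?P *v x) \<bullet> y = (?P *v x) \<bullet> y"
    by (metis inner_commute)
qed

lemma eigenprojection_idem [simp]:
  "eigenprojection a l ** eigenprojection a l = eigenprojection a l"
  by (simp add: matrix_eq eigenprojection_fix eigenprojection_in flip: matrix_vector_mul_assoc)

lemma mult_eigenprojection: "a ** eigenprojection a l = l *\<^sub>R eigenprojection a l"
proof -
  have "a *v (eigenprojection a l *v x) = l *\<^sub>R (eigenprojection a l *v x)" for x
    using eigenprojection_in[of a l x] by (simp add: eigenspace_def)
  then show ?thesis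
    by (simp add: matrix_eq mv.scaleR_left flip: matrix_vector_mul_assoc)
qed

text \<open>Cyclicity of the trace together with P P = P. A weight of \<open>b\<close> can thus be
  read off from the action of \<open>b\<close> on the eigenspace.\<close>

lemma inner_eigenprojection_self:
  "eigenprojection a l \<bullet> (b ** eigenprojection a l) = eigenprojection a l \<bullet> b"
  using inner_matrix_mult_right[of "eigenprojection a l" "eigenprojection a l" b] by simp

text \<open>With P and Q the two projections, tr(P Q) is the squared Frobenius norm of P Q. These
  are the weights in Klein's inequality.\<close>

lemma inner_two_eigenprojections_nonneg: "0 \<le> eigenprojection a l \<bullet> eigenprojection b m"
proof -
  have "(eigenprojection a l ** eigenprojection b m) \<bullet> (eigenprojection a l ** eigenprojection b m)
    = eigenprojection b m \<bullet> eigenprojection a l"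
    by (simp add: inner_matrix_mult_left matrix_mul_assoc inner_eigenprojection_self)
  then show ?thesis by (metis inner_commute inner_ge_zero)
qed

section \<open>Spectral decomposition of a hermitian matrix\<close>

context
  fixes a :: "complex^'n^'n"
  assumes a: "mat_adjoint a = a"
begin

lemma hermitian_inner: "(a *v x) \<bullet> y = x \<bullet> (a *v y)"
  by (simp add: inner_matrix_vector_mult a)

lemma eigenspace_orthogonal:
  assumes "x \<in> eigenspace a l" "y \<in> eigenspace a m" "l \<noteq> m" shows "x \<bullet> y = 0"
proof -
  have "l * (x \<bullet> y) = m * (x \<bullet> y)"
    using hermitian_inner[of x y] assms(1,2) by (simp add: eigenspace_def)
  with assms(3) show ?thesis by simp
qed

text \<open>One eigenvector per eigenvalue gives an orthogonal family of nonzero vectors, hence an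
  independent one.\<close>

lemma finite_eigvals: "finite (eigvals a)"
proof -
  have "\<forall>l\<in>eigvals a. \<exists>v. v \<noteq> 0 \<and> v \<in> eigenspace a l"
    by (auto elim!: eigvalsE simp: eigenspace_def)
  then obtain f where f: "\<And>l. l \<in> eigvals a \<Longrightarrow> f l \<noteq> 0 \<and> f l \<in> eigenspace a l"
    by metis
  have orth: "f l \<bullet> f m = 0" if "l \<in> eigvals a" "m \<in> eigvals a" "l \<noteq> m" for l m
    using eigenspace_orthogonal f that by blast
  then have "inj_on f (eigvals a)"
    using f by (metis inj_onI inner_eq_zero_iff)
  moreover have "independent (f ` eigvals a)"
    using f orth by (intro pairwise_orthogonal_independent) (auto simp: pairwise_def orthogonal_def)
  ultimately show ?thesis
    using independent_bound finite_imageD by blast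
qed

lemma eigenprojection_mult_other:
  assumes "l \<noteq> m" shows "eigenprojection a l ** eigenprojection a m = 0"
proof (rule matrix_eqI_inner)
  fix x y
  show "((eigenprojection a l ** eigenprojection a m) *v x) \<bullet> y = (0 *v x) \<bullet> y"
    using eigenspace_orthogonal[OF eigenprojection_in[of a m x] eigenprojection_in[of a l y]] assms
    by (simp add: inner_matrix_vector_mult flip: matrix_vector_mul_assoc)
qed

lemma inner_eigenprojection_other:
  assumes "l \<noteq> m" shows "eigenprojection a l \<bullet> eigenprojection a m = 0"
  using inner_eigenprojection_self[of a l "eigenprojection a m"]
    eigenprojection_mult_other[of m l] assms by simp

text \<open>A maximiser of the quadratic form on the unit sphere of an invariant subspace is an
  eigenvector.\<close>

lemma invariant_subspace_has_eigenvector: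
  assumes W: "subspace W" "\<And>x. x \<in> W \<Longrightarrow> a *v x \<in> W" and "\<exists>x\<in>W. x \<noteq> 0"
  shows "\<exists>l. \<exists>v\<in>W. v \<noteq> 0 \<and> v \<in> eigenspace a l"
proof -
  let ?q = "\<lambda>v. v \<bullet> (a *v v)"
  from assms(3) obtain x where x: "x \<in> W" "x \<noteq> 0" by blast
  have "compact (sphere 0 1 \<inter> W)"
    using W(1) by (intro compact_Int_closed closed_subspace) auto
  moreover have "(1 / norm x) *\<^sub>R x \<in> sphere 0 1 \<inter> W"
    using x W(1) by (simp add: subspace_scale)
  moreover have "continuous_on (sphere 0 1 \<inter> W) ?q"
    by (intro continuous_intros linear_continuous_on matrix_vector_mul_bounded_linear)
  ultimately obtain v where v: "v \<in> sphere 0 1 \<inter> W"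
    and max: "\<And>w. w \<in> sphere 0 1 \<inter> W \<Longrightarrow> ?q w \<le> ?q v"
    using continuous_attains_sup[of "sphere 0 1 \<inter> W" ?q] by blast
  define l where "l = ?q v"
  define u where "u = a *v v - l *\<^sub>R v"
  have u: "u \<in> W"
    using v W by (simp add: u_def subspace_diff subspace_scale)
  have bound: "?q w \<le> l * (w \<bullet> w)" if "w \<in> W" for w
  proof (cases "w = 0")
    case False
    have "?q ((1 / norm w) *\<^sub>R w) \<le> l"
      unfolding l_def using False that W(1) by (intro max) (simp add: subspace_scale)
    then show ?thesis
      using False by (simp add: mv.scaleR_right field_simps power2_eq_square flip: power2_norm_eq_inner)
  qed simp
  \<comment> \<open>Maximality of \<open>v\<close>, tested in the direction of the residual
    \<open>u\<close> and expanded in powers of \<open>t\<close>: a nonzero linear coefficient would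
    violate it for small positive \<open>t\<close>.\<close>
  have ineq: "2 * t * (u \<bullet> u) + t\<^sup>2 * (?q u - l * (u \<bullet> u)) \<le> 0" for t
  proof -
    have "v + t *\<^sub>R u \<in> W" using u v W(1) by (simp add: subspace_add subspace_scale)
    then have "?q (v + t *\<^sub>R u) \<le> l * ((v + t *\<^sub>R u) \<bullet> (v + t *\<^sub>R u))" by (rule bound)
    moreover have "?q (v + t *\<^sub>R u) = l + 2 * t * (u \<bullet> (a *v v)) + t\<^sup>2 * ?q u"
      using hermitian_inner[of v u] inner_commute[of u "a *v v"]
      by (simp add: l_def mv.add_right mv.scaleR_right inner_add_left inner_add_right
          power2_eq_square distrib_left)
    moreover have "(v + t *\<^sub>R u) \<bullet> (v + t *\<^sub>R u) = 1 + 2 * t * (u \<bullet> v) + t\<^sup>2 * (u \<bullet> u)"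
      using v inner_commute[of v u]
      by (simp add: inner_add_left inner_add_right distrib_left power2_eq_square norm_eq_1)
    ultimately have "l + 2 * t * (u \<bullet> (a *v v)) + t\<^sup>2 * ?q u
      \<le> l * (1 + 2 * t * (u \<bullet> v) + t\<^sup>2 * (u \<bullet> u))" by simp
    moreover have "u \<bullet> (a *v v) = u \<bullet> u + l * (u \<bullet> v)"
      by (simp add: u_def inner_diff_right)
    ultimately show ?thesis by (simp add: algebra_simps)
  qed
  have "u \<bullet> u = 0"
  proof (rule ccontr)
    assume "u \<bullet> u \<noteq> 0"
    then have pos: "u \<bullet> u > 0" by simp
    \<comment> \<open>The quadratic coefficient has modulus below \<open>c\<close>, so at
      \<open>t = (u \<bullet> u) / c\<close> the quadratic term costs at most half of the linear
      one.\<close>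
    define c where "c = \<bar>?q u - l * (u \<bullet> u)\<bar> + 1"
    define t where "t = (u \<bullet> u) / c"
    have c: "c > 0" "- c \<le> ?q u - l * (u \<bullet> u)" by (simp_all add: c_def)
    have t: "t > 0" using pos c by (simp add: t_def)
    have "2 * t * (u \<bullet> u) + t\<^sup>2 * (- c) \<le> 0"
      using ineq[of t] mult_left_mono[OF c(2), of "t\<^sup>2"] by simp
    moreover have "t\<^sup>2 * c = t * (u \<bullet> u)" using c by (simp add: t_def power2_eq_square)
    ultimately show False using mult_pos_pos[OF t pos] by linarith
  qed
  then have "v \<in> eigenspace a l" by (simp add: u_def eigenspace_def)
  with v show ?thesis by (intro exI[of _ l] bexI[of _ v]) auto
qed

text \<open>The orthogonal complement of all eigenspaces is invariant; if nonzero, it would contain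
  an eigenvector, which would be orthogonal to itself. What remains of a vector after subtracting
  all its projections lies there.\<close>

lemma sum_eigenprojection: "(\<Sum>l\<in>eigvals a. eigenprojection a l) = mat 1"
proof -
  define W where "W = {x. \<forall>l. \<forall>y\<in>eigenspace a l. x \<bullet> y = 0}"
  have "subspace W" by (auto simp: W_def subspace_def inner_add_left)
  moreover have "a *v x \<in> W" if "x \<in> W" for x
    using that by (auto simp: W_def hermitian_inner eigenspace_def)
  ultimately have W: "x = 0" if "x \<in> W" for x
    using invariant_subspace_has_eigenvector[of W] that by (force simp: W_def)
  have "x - (\<Sum>l\<in>eigvals a. eigenprojection a l *v x) = 0" for x
  proof (rule W, unfold W_def, safe)
    fix m y assume y: "y \<in> eigenspace a m"
    show "(x - (\<Sum>l\<in>eigvals a. eigenprojection a l *v x)) \<bullet> y = 0"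
    proof (cases "y = 0")
      case False
      then have m: "m \<in> eigvals a" using y eigvalsI by blast
      have "(\<Sum>l\<in>eigvals a. eigenprojection a l *v x) \<bullet> y
        = (\<Sum>l\<in>eigvals a. if l = m then (eigenprojection a m *v x) \<bullet> y else 0)"
        unfolding inner_sum_left
        by (intro sum.cong) (auto intro: eigenspace_orthogonal[OF eigenprojection_in y])
      also have "\<dots> = (eigenprojection a m *v x) \<bullet> y"
        using m by (simp add: finite_eigvals)
      finally show ?thesis
        using eigenprojection_orthogonal[OF y, of x] by (simp add: inner_diff_left)
    qed simp
  qed
  then show ?thesis by (simp add: matrix_eq mv.sum_left)
qed

end

subsection \<open>Continuity of the functional calculus\<close>

text \<open>Only the values of \<open>f\<close> on the finite set of eigenvalues matter, so
  \<open>f\<close> may be discontinuous or carry a conventional value, as \<open>ln\<close> does at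
  0.\<close>

definition fcalc :: "(real \<Rightarrow> real) \<Rightarrow> complex^'n^'n \<Rightarrow> complex^'n^'n" where
  "fcalc f a = (\<Sum>l\<in>eigvals a. f l *\<^sub>R eigenprojection a l)"

lemma fcalc_cong: "(\<And>l. l \<in> eigvals a \<Longrightarrow> f l = g l) \<Longrightarrow> fcalc f a = fcalc g a"
  by (simp add: fcalc_def)

lemma fcalc_diff: "fcalc (\<lambda>x. f x - g x) a = fcalc f a - fcalc g a"
  by (simp add: fcalc_def algebra_simps sum_subtractf)

lemma fcalc_scale: "fcalc (\<lambda>x. c * f x) a = c *\<^sub>R fcalc f a"
  by (simp add: fcalc_def scaleR_sum_right)

lemma fcalc_sum: "fcalc (\<lambda>x. \<Sum>i\<in>I. f i x) a = (\<Sum>i\<in>I. fcalc (f i) a)"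
  unfolding fcalc_def scaleR_sum_left by (rule sum.swap)

lemma fcalc_mult_id: "fcalc (\<lambda>x. x * f x) a = a ** fcalc f a"
  by (simp add: fcalc_def mm.sum_right mm.scaleR_right mult_eigenprojection mult.commute)

lemma fcalc_1: "mat_adjoint a = a \<Longrightarrow> fcalc (\<lambda>_. 1) a = mat 1"
  by (simp add: fcalc_def sum_eigenprojection)

lemma fcalc_id: "mat_adjoint a = a \<Longrightarrow> fcalc (\<lambda>x. x) a = a"
  using fcalc_mult_id[of "\<lambda>_. 1" a] by (simp add: fcalc_1)

lemma inner_fcalc: "b \<bullet> fcalc f a = (\<Sum>l\<in>eigvals a. f l * (b \<bullet> eigenprojection a l))"
  by (simp add: fcalc_def inner_sum_right)

text \<open>The eigenprojections are orthogonal in the Frobenius inner product, so Pythagoras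
  compares \<open>fcalc f a\<close> with the identity term by term. The bound is independent of
  \<open>a\<close>, as uniform approximation along a sequence requires.\<close>

lemma norm_fcalc_le:
  fixes a :: "complex^'n^'n"
  assumes a: "mat_adjoint a = a" and f: "\<And>l. l \<in> eigvals a \<Longrightarrow> \<bar>f l\<bar> \<le> B"
  shows "(norm (fcalc f a))\<^sup>2 \<le> B\<^sup>2 * (norm (mat 1 :: complex^'n^'n))\<^sup>2"
proof -
  let ?E = "eigenprojection a"
  have diag: "fcalc g a \<bullet> fcalc g a = (\<Sum>l\<in>eigvals a. (g l)\<^sup>2 * (?E l \<bullet> ?E l))" for g
  proof -
    have "?E l \<bullet> fcalc g a = g l * (?E l \<bullet> ?E l)" if "l \<in> eigvals a" for l
      using that unfolding inner_fcalc
      by (subst sum.remove[OF finite_eigvals[OF a] that])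
        (auto intro!: sum.neutral simp: inner_eigenprojection_other[OF a])
    then show ?thesis
      by (subst (1) fcalc_def) (simp add: inner_sum_left power2_eq_square mult.assoc)
  qed
  have "(norm (fcalc f a))\<^sup>2 \<le> (\<Sum>l\<in>eigvals a. B\<^sup>2 * (?E l \<bullet> ?E l))"
    unfolding power2_norm_eq_inner diag
    by (intro sum_mono mult_right_mono) (auto dest!: f intro: power2_le_iff_abs_le[THEN iffD2] order_trans[OF abs_ge_zero])
  also have "\<dots> = B\<^sup>2 * (norm (mat 1 :: complex^'n^'n))\<^sup>2"
    unfolding power2_norm_eq_inner fcalc_1[OF a, symmetric] diag by (simp add: sum_distrib_left)
  finally show ?thesis .
qed

lemma tendsto_fcalc_power:
  assumes "x \<longlonglongrightarrow> a" "mat_adjoint a = a" "\<And>i. mat_adjoint (x i) = x i"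
  shows "(\<lambda>i. fcalc (\<lambda>t. t ^ k) (x i)) \<longlonglongrightarrow> fcalc (\<lambda>t. t ^ k) a"
proof (induction k)
  case 0
  then show ?case using assms by (simp add: fcalc_1)
next
  case (Suc k)
  then show ?case using mm.tendsto[OF assms(1)] by (simp add: fcalc_mult_id)
qed

text \<open>Polynomials converge by continuity of the matrix product. Uniform approximation on one
  compact set containing all spectra costs an error that does not depend on the index.\<close>

lemma tendsto_fcalc:
  fixes a :: "complex^'n^'n"
  assumes lim: "x \<longlonglongrightarrow> a" and a: "mat_adjoint a = a" and x: "\<And>i. mat_adjoint (x i) = x i"
    and K: "compact K" "eigvals a \<subseteq> K" "\<And>i. eigvals (x i) \<subseteq> K" "continuous_on K f"
  shows "(\<lambda>i. fcalc f (x i)) \<longlonglongrightarrow> fcalc f a"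
proof (rule tendstoI)
  fix e :: real assume e: "e > 0"
  define N where "N = norm (mat 1 :: complex^'n^'n)"
  have N: "N \<ge> 0" by (simp add: N_def)
  \<comment> \<open>Brings the error \<open>d * N\<close> of one approximation below e / 3; the
    summand 1 makes this strict.\<close>
  define d where "d = e / (3 * (N + 1))"
  have d: "d > 0" "d * N < e / 3" using e N by (auto simp: d_def field_simps)
  obtain g where g: "real_polynomial_function g" "\<And>t. t \<in> K \<Longrightarrow> \<bar>f t - g t\<bar> < d"
    using Stone_Weierstrass_real_polynomial_function[OF K(1,4) d(1)] by metis
  then obtain c n where "g = (\<lambda>t. \<Sum>i\<le>n. c i * t ^ i)"
    by (auto simp: real_polynomial_function_iff_sum)
  then have "(\<lambda>i. fcalc g (x i)) \<longlonglongrightarrow> fcalc g a"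
    using tendsto_fcalc_power[OF lim a x] by (simp add: fcalc_sum fcalc_scale) (intro tendsto_intros)
  then have ev: "\<forall>\<^sub>F i in sequentially. dist (fcalc g (x i)) (fcalc g a) < e / 3"
    using e by (intro tendstoD) auto
  have close: "dist (fcalc f b) (fcalc g b) < e / 3"
    if "mat_adjoint b = b" "eigvals b \<subseteq> K" for b :: "complex^'n^'n"
  proof -
    have "(norm (fcalc (\<lambda>t. f t - g t) b))\<^sup>2 \<le> d\<^sup>2 * N\<^sup>2"
      unfolding N_def using that g(2) by (intro norm_fcalc_le) force+
    then have "(norm (fcalc f b - fcalc g b))\<^sup>2 \<le> (d * N)\<^sup>2"
      by (simp add: fcalc_diff power_mult_distrib)
    then have "norm (fcalc f b - fcalc g b) \<le> d * N"
      by (rule power2_le_imp_le) (use d N in auto)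
    then show ?thesis using d by (simp add: dist_norm)
  qed
  show "\<forall>\<^sub>F i in sequentially. dist (fcalc f (x i)) (fcalc f a) < e"
    using ev
  proof eventually_elim
    case (elim i)
    show ?case
      using elim close[OF a K(2)] close[OF x K(3), of i]
        dist_triangle[of "fcalc f (x i)" "fcalc f a" "fcalc g (x i)"]
        dist_triangle[of "fcalc g (x i)" "fcalc f a" "fcalc g a"]
      by (simp add: dist_commute)
  qed
qed

subsection \<open>States\<close>

definition mker :: "complex^'n^'n \<Rightarrow> (complex^'n) set" where
  "mker a = {v. a *v v = 0}"

lemma psd_hermitian: "psd a \<Longrightarrow> mat_adjoint a = a"
  and psd_nonneg: "psd a \<Longrightarrow> 0 \<le> v \<bullet> (a *v v)"
  by (simp_all add: psd_def)

lemma eigenprojection_not_eigval: "l \<notin> eigvals a \<Longrightarrow> eigenprojection a l = 0"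
  using eigenprojection_in[of a l] by (simp add: eigvals_def matrix_eq)

lemma fcalc_indicator:
  assumes "mat_adjoint a = a"
  shows "fcalc (\<lambda>x. if x = m then 1 else 0) a = eigenprojection a m"
proof -
  have "fcalc (\<lambda>x. if x = m then 1 else 0) a
    = (\<Sum>l\<in>eigvals a. if l = m then eigenprojection a m else 0)"
    unfolding fcalc_def by (intro sum.cong) auto
  then show ?thesis
    by (simp add: finite_eigvals[OF assms] eigenprojection_not_eigval)
qed

lemma mult_eigenprojection_0:
  assumes "mker a \<subseteq> mker b" shows "b ** eigenprojection a 0 = 0"
proof -
  have "eigenprojection a 0 *v x \<in> mker b" for x
    using eigenprojection_in[of a 0 x] assms by (auto simp: eigenspace_def mker_def)
  then show ?thesis by (simp add: matrix_eq mker_def flip: matrix_vector_mul_assoc)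
qed

text \<open>Weighted by \<open>b\<close>, the spectrum of \<open>a\<close> has no mass at 0, so the
  value of a function at 0 does not enter inner products with \<open>b\<close>. This makes the
  convention for \<open>ln 0\<close> harmless.\<close>

lemma inner_eigenprojection_0:
  assumes "mker a \<subseteq> mker b" shows "b \<bullet> eigenprojection a 0 = 0"
  using inner_eigenprojection_self[of a 0 b] mult_eigenprojection_0[OF assms]
  by (simp add: inner_commute)

text \<open>Writes a spectral weight as a sum of values of the quadratic form of \<open>b\<close>,
  so that inequalities between forms pass to weights.\<close>

lemma inner_eigenprojection_column:
  "b \<bullet> eigenprojection a l =
    (\<Sum>j\<in>UNIV. column j (eigenprojection a l) \<bullet> (b *v column j (eigenprojection a l)))"
  by (subst inner_commute, subst inner_eigenprojection_self[symmetric])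
    (simp add: inner_eq_sum_column column_matrix_mult)

text \<open>Weights are compared eigenvalue by eigenvalue. The sign condition on \<open>f\<close>
  leaves out 0, where both weights vanish: the function \<open>tail d\<close>, to which this will be
  applied, has the possibly negative value \<open>ln d\<close> there.\<close>

lemma inner_fcalc_mono:
  assumes "\<And>v. v \<bullet> (b *v v) \<le> k * (v \<bullet> (c *v v))"
    and "mker a \<subseteq> mker b" "mker a \<subseteq> mker c"
    and f: "\<And>l. l \<in> eigvals a \<Longrightarrow> l \<noteq> 0 \<Longrightarrow> 0 \<le> f l"
  shows "b \<bullet> fcalc f a \<le> k * (c \<bullet> fcalc f a)"
  unfolding inner_fcalc sum_distrib_left
proof (rule sum_mono)
  fix l assume l: "l \<in> eigvals a"
  show "f l * (b \<bullet> eigenprojection a l) \<le> k * (f l * (c \<bullet> eigenprojection a l))"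
  proof (cases "l = 0")
    case True
    then show ?thesis using assms(2,3) by (simp add: inner_eigenprojection_0)
  next
    case False
    have "b \<bullet> eigenprojection a l \<le> k * (c \<bullet> eigenprojection a l)"
      unfolding inner_eigenprojection_column sum_distrib_left by (intro sum_mono assms(1))
    then have "f l * (b \<bullet> eigenprojection a l) \<le> f l * (k * (c \<bullet> eigenprojection a l))"
      using f[OF l False] by (rule mult_left_mono)
    then show ?thesis by (simp add: mult.left_commute)
  qed
qed

lemma inner_fcalc_nonneg:
  assumes "psd b" "mker a \<subseteq> mker b" "\<And>l. l \<in> eigvals a \<Longrightarrow> l \<noteq> 0 \<Longrightarrow> 0 \<le> f l"
  shows "0 \<le> b \<bullet> fcalc f a"
  using inner_fcalc_mono[of 0 1 b a f] assms psd_nonneg by (auto simp: mker_def)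

lemma psd_eigvals_nonneg:
  assumes "psd a" "l \<in> eigvals a" shows "0 \<le> l"
proof -
  obtain v where "v \<noteq> 0" "a *v v = l *\<^sub>R v" using assms(2) by (rule eigvalsE)
  then have "0 \<le> l * (v \<bullet> v)" "v \<bullet> v > 0" using psd_nonneg[OF assms(1), of v] by auto
  then show ?thesis by (metis not_le mult_neg_pos)
qed

lemma psd_least_positive_eigval:
  assumes "psd a"
  obtains d where "d > 0" "\<And>l. l \<in> eigvals a \<Longrightarrow> l \<noteq> 0 \<Longrightarrow> d \<le> l"
proof
  have fin: "finite (eigvals a)" by (rule finite_eigvals[OF psd_hermitian[OF assms]])
  \<comment> \<open>The element 1 keeps the set nonempty when 0 is the only eigenvalue.\<close>
  show "Min (insert 1 (eigvals a - {0})) > 0"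
    using fin psd_eigvals_nonneg[OF assms] by (subst Min_gr_iff) (auto simp: less_le)
  show "Min (insert 1 (eigvals a - {0})) \<le> l" if "l \<in> eigvals a" "l \<noteq> 0" for l
    using that fin by (intro Min_le) auto
qed

text \<open>On the image of \<open>a\<close> the form of \<open>a\<close> is bounded below by its least positive eigenvalue.\<close>

lemma form_bounded_by_psd:
  assumes a: "psd a"
  obtains k where "k > 0"
    "\<And>b v. mat_adjoint b = b \<Longrightarrow> mker a \<subseteq> mker b \<Longrightarrow> \<bar>v \<bullet> (b *v v)\<bar> \<le> k * norm b * (v \<bullet> (a *v v))"
proof -
  note ah = psd_hermitian[OF a]
  let ?E = "eigenprojection a"
  obtain c where c: "c > 0" "\<And>l. l \<in> eigvals a \<Longrightarrow> l \<noteq> 0 \<Longrightarrow> c \<le> l"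
    using psd_least_positive_eigval[OF a] by blast
  show thesis
  proof
    show "1 / c > 0" using c by simp
    fix b v assume b: "mat_adjoint b = b" and ker: "mker a \<subseteq> mker b"
    \<comment> \<open>Removing the kernel component of \<open>v\<close> does not change the form of
      \<open>b\<close>; what is left is controlled by the positive eigenvalues of
      \<open>a\<close>.\<close>
    define u where "u = v - ?E 0 *v v"
    have bE: "b *v (?E 0 *v v) = 0"
      using mult_eigenprojection_0[OF ker] by (simp add: matrix_vector_mul_assoc)
    have "v \<bullet> (b *v v) = u \<bullet> (b *v u)"
      using hermitian_inner[OF b, of "?E 0 *v v" v] bE
      by (simp add: u_def mv.diff_right inner_diff_left)
    then have "\<bar>v \<bullet> (b *v v)\<bar> \<le> norm u * norm (b *v u)"
      by (simp add: Cauchy_Schwarz_ineq2)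
    also have "\<dots> \<le> norm u * (norm b * norm u)"
      by (intro mult_left_mono norm_matrix_vector_mult_le) auto
    also have "\<dots> = norm b * (u \<bullet> u)" by (simp add: power2_eq_square flip: power2_norm_eq_inner)
    finally have 1: "\<bar>v \<bullet> (b *v v)\<bar> \<le> norm b * (u \<bullet> u)" .
    have form: "v \<bullet> (fcalc f a *v v) = (\<Sum>l\<in>eigvals a. f l * (v \<bullet> (?E l *v v)))" for f
      by (simp add: fcalc_def mv.sum_left mv.scaleR_left inner_sum_right)
    have E_nonneg: "0 \<le> v \<bullet> (?E l *v v)" for l
    proof -
      have "v \<bullet> (?E l *v v) = (?E l *v v) \<bullet> (?E l *v v)"
        by (simp add: inner_matrix_vector_mult matrix_vector_mul_assoc)
      then show ?thesis by simp
    qed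
    have uu: "u \<bullet> u = u \<bullet> v"
      using eigenprojection_orthogonal[OF eigenprojection_in, of v a 0 v]
      by (simp add: u_def inner_diff_right)
    have "u = fcalc (\<lambda>x. 1 - (if x = 0 then 1 else 0)) a *v v"
      by (simp only: u_def fcalc_diff fcalc_1[OF ah] fcalc_indicator[OF ah] mv.diff_left
          matrix_vector_mul_lid)
    with uu have "u \<bullet> u = v \<bullet> (fcalc (\<lambda>x. 1 - (if x = 0 then 1 else 0)) a *v v)"
      by (metis inner_commute)
    then have "c * (u \<bullet> u)
        = (\<Sum>l\<in>eigvals a. c * (1 - (if l = 0 then 1 else 0)) * (v \<bullet> (?E l *v v)))"
      by (simp only: form sum_distrib_left mult.assoc)
    \<comment> \<open>Term by term: the coefficient on the left is 0 at the eigenvalue 0 and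
      \<open>c\<close> at the positive ones, which are at least \<open>c\<close>.\<close>
    also have "\<dots> \<le> (\<Sum>l\<in>eigvals a. l * (v \<bullet> (?E l *v v)))"
      using c E_nonneg by (intro sum_mono mult_right_mono) auto
    also have "\<dots> = v \<bullet> (a *v v)"
      using form[of "\<lambda>x. x"] by (simp add: fcalc_id[OF ah])
    finally have "u \<bullet> u \<le> 1 / c * (v \<bullet> (a *v v))"
      using c by (simp add: field_simps)
    then have "norm b * (u \<bullet> u) \<le> norm b * (1 / c * (v \<bullet> (a *v v)))"
      by (rule mult_left_mono) simp
    with 1 show "\<bar>v \<bullet> (b *v v)\<bar> \<le> 1 / c * norm b * (v \<bullet> (a *v v))" by (simp add: mult_ac)
  qed
qed

text \<open>The form of \<open>a ** a\<close> at \<open>v\<close> is the squared norm of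
  \<open>a *v v\<close>, and the preceding bound controls it by the form of
  \<open>a\<close>.\<close>

lemma psd_form_zero:
  assumes a: "psd a" and "v \<bullet> (a *v v) = 0" shows "v \<in> mker a"
proof -
  have ah: "mat_adjoint a = a" using a by (rule psd_hermitian)
  obtain k where k: "k > 0" "\<And>b v. mat_adjoint b = b \<Longrightarrow> mker a \<subseteq> mker b \<Longrightarrow>
      \<bar>v \<bullet> (b *v v)\<bar> \<le> k * norm b * (v \<bullet> (a *v v))"
    using form_bounded_by_psd[OF a] by blast
  have "mat_adjoint (a ** a) = a ** a" "mker a \<subseteq> mker (a ** a)"
    by (auto simp: mat_adjoint_mult ah mker_def mv.zero_right simp flip: matrix_vector_mul_assoc)
  then have "v \<bullet> ((a ** a) *v v) = 0" using k(2)[of "a ** a" v] assms(2) by simp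
  then have "(a *v v) \<bullet> (a *v v) = 0"
    by (simp add: hermitian_inner[OF ah] matrix_vector_mul_assoc)
  then show ?thesis by (simp add: mker_def)
qed

lemma mker_antimono_form:
  assumes "psd a" "psd b" "\<And>v. v \<bullet> (b *v v) \<le> k * (v \<bullet> (a *v v))"
  shows "mker a \<subseteq> mker b"
proof
  fix v assume "v \<in> mker a"
  then have "v \<bullet> (b *v v) \<le> 0" using assms(3)[of v] by (simp add: mker_def)
  then have "v \<bullet> (b *v v) = 0" using psd_nonneg[OF assms(2), of v] by simp
  then show "v \<in> mker b" by (rule psd_form_zero[OF assms(2)])
qed

text \<open>The image of a hermitian matrix is the orthogonal complement of its kernel. Finiteness
  of a relative entropy becomes a condition on kernels, which is easy to follow through limits and
  convex combinations.\<close>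

lemma range_subset_iff_mker:
  assumes a: "mat_adjoint a = a" and b: "mat_adjoint b = b"
  shows "range ((*v) b) \<subseteq> range ((*v) a) \<longleftrightarrow> mker a \<subseteq> mker b"
proof
  assume *: "range ((*v) b) \<subseteq> range ((*v) a)"
  show "mker a \<subseteq> mker b"
  proof
    fix v assume v: "v \<in> mker a"
    obtain w where w: "b *v (b *v v) = a *v w" using * by blast
    have "(b *v v) \<bullet> (b *v v) = v \<bullet> (a *v w)" by (simp add: hermitian_inner[OF b] w)
    also have "\<dots> = 0" using v by (simp add: mker_def flip: hermitian_inner[OF a])
    finally show "v \<in> mker b" by (simp add: mker_def)
  qed
next
  assume ker: "mker a \<subseteq> mker b"
  have E0: "eigenprojection a 0 ** b = 0"
    using arg_cong[OF mult_eigenprojection_0[OF ker], of mat_adjoint]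
    by (simp add: mat_adjoint_mult b mat_adjoint_linear)
  \<comment> \<open>\<open>fcalc inverse a\<close> acts as a pseudo-inverse: its product with
    \<open>a\<close> projects onto the complement of the kernel and so leaves \<open>b\<close>
    unchanged.\<close>
  have "a ** fcalc inverse a = fcalc (\<lambda>x. 1 - (if x = 0 then 1 else 0)) a"
    unfolding fcalc_mult_id[symmetric] by (rule fcalc_cong) auto
  also have "\<dots> = mat 1 - eigenprojection a 0"
    by (simp only: fcalc_diff fcalc_1[OF a] fcalc_indicator[OF a])
  finally have "a ** (fcalc inverse a ** b) = b"
    by (simp add: matrix_mul_assoc mm.diff_left E0)
  then have "b *v v = a *v ((fcalc inverse a ** b) *v v)" for v
    by (metis matrix_vector_mul_assoc)
  then show "range ((*v) b) \<subseteq> range ((*v) a)" by auto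
qed

section \<open>Spectra of states\<close>

lemma state_psd: "\<rho> \<in> state_space A \<Longrightarrow> psd \<rho>"
  by (simp add: state_space_def)

lemmas state_hermitian = psd_hermitian[OF state_psd]

lemma state_inner_1: "\<rho> \<in> state_space A \<Longrightarrow> mat 1 \<bullet> \<rho> = 1"
  by (simp add: state_space_def flip: Re_trace)

text \<open>The trace of a projection is its squared Frobenius norm, which is at least 1 since the
  projection fixes a nonzero vector.\<close>

lemma mat_1_inner_eigenprojection_ge_1:
  assumes "l \<in> eigvals a" shows "1 \<le> mat 1 \<bullet> eigenprojection a l"
proof -
  let ?P = "eigenprojection a l"
  obtain v where v: "v \<noteq> 0" "?P *v v = v"
    using assms by (elim eigvalsE) (auto simp: eigenspace_def intro!: eigenprojection_fix that)
  then have "1 \<le> norm ?P" using norm_matrix_vector_mult_le[of ?P v] by simp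
  then have "1 \<le> ?P \<bullet> ?P" by (simp flip: power2_norm_eq_inner)
  also have "?P \<bullet> ?P = mat 1 \<bullet> ?P"
    using inner_eigenprojection_self[of a l "mat 1"] by (simp add: inner_commute)
  finally show ?thesis .
qed

text \<open>An eigenvalue is at most its own contribution to the trace. The common interval is the
  compact set that \<open>tendsto_fcalc\<close> asks for.\<close>

lemma state_eigvals: "\<rho> \<in> state_space A \<Longrightarrow> eigvals \<rho> \<subseteq> {0..1}"
proof
  fix l assume \<rho>: "\<rho> \<in> state_space A" and l: "l \<in> eigvals \<rho>"
  note nonneg = psd_eigvals_nonneg[OF state_psd[OF \<rho>]]
  have "l \<le> l * (mat 1 \<bullet> eigenprojection \<rho> l)"
    using mult_left_mono[OF mat_1_inner_eigenprojection_ge_1[OF l] nonneg[OF l]] by simp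
  also have "\<dots> \<le> mat 1 \<bullet> fcalc (\<lambda>x. x) \<rho>"
    unfolding inner_fcalc using nonneg mat_1_inner_eigenprojection_ge_1[of _ \<rho>] l
    by (intro member_le_sum finite_eigvals state_hermitian[OF \<rho>]) (force intro!: mult_nonneg_nonneg)+
  also have "\<dots> = 1"
    using \<rho> by (simp add: fcalc_id state_hermitian state_inner_1)
  finally show "l \<in> {0..1}" using nonneg[OF l] by simp
qed

lemma tendsto_fcalc_state:
  assumes "x \<longlonglongrightarrow> a" "a \<in> state_space A" "\<And>i. x i \<in> state_space A" "continuous_on {0..1} f"
  shows "(\<lambda>i. fcalc f (x i)) \<longlonglongrightarrow> fcalc f a"
  by (rule tendsto_fcalc[where K = "{0..1}", OF assms(1) state_hermitian[OF assms(2)]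
        state_hermitian[OF assms(3)] compact_Icc state_eigvals[OF assms(2)]
        state_eigvals[OF assms(3)] assms(4)])

text \<open>Pairing \<open>a\<close> with its own functional calculus supplies a factor t, which
  tames the logarithm at 0.\<close>

lemma inner_fcalc_self:
  assumes "mat_adjoint a = a" shows "a \<bullet> fcalc f a = mat 1 \<bullet> fcalc (\<lambda>x. x * f x) a"
  using inner_matrix_mult_left[of a "mat 1" "fcalc f a"] assms by (simp add: fcalc_mult_id)

subsection \<open>Klein's inequality\<close>

lemma mat_log_eq_fcalc:
  assumes "psd a" shows "mat_log a = fcalc ln a"
  unfolding mat_log_def fcalc_def
proof (rule sum.mono_neutral_left)
  show "finite (eigvals a)" using assms by (simp add: finite_eigvals psd_hermitian)
  \<comment> \<open>Only l = 0 is left, where \<open>ln 0 = 0\<close> removes the term.\<close>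
  show "\<forall>l\<in>eigvals a - {l. 0 < l \<and> eigenspace a l \<noteq> {0}}. ln l *\<^sub>R eigenprojection a l = 0"
    using psd_eigvals_nonneg[OF assms] by (force simp: eigvals_def)
qed (auto simp: eigvals_def)

lemma rel_entropy_state:
  assumes \<rho>: "\<rho> \<in> state_space A" and \<sigma>: "\<sigma> \<in> state_space A"
  shows "rel_entropy \<rho> \<sigma> =
    (if mker \<sigma> \<subseteq> mker \<rho> then ereal (\<rho> \<bullet> fcalc ln \<rho> - \<rho> \<bullet> fcalc ln \<sigma>) else \<infinity>)"
  by (simp add: rel_entropy_def range_subset_iff_mker[OF state_hermitian[OF \<sigma>] state_hermitian[OF \<rho>]]
      mat_log_eq_fcalc[OF state_psd[OF \<rho>]] mat_log_eq_fcalc[OF state_psd[OF \<sigma>]]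
      Re_trace_mult state_hermitian[OF \<rho>] inner_diff_right)

text \<open>As a function of \<open>l\<close>, right side minus left side has derivative ln l - ln m
  - (l - m), which has the sign of l - m because the logarithm grows at least as fast as the
  identity on (0, 1]. The minimum is therefore the value 0 at l = m. The factor 1/2 comes from the
  second derivative 1 / l >= 1 of l ln l.\<close>

lemma klein_scalar:
  fixes l m :: real
  assumes "0 \<le> l" "l \<le> 1" "0 \<le> m" "m \<le> 1" "m = 0 \<Longrightarrow> l = 0"
  shows "(l - m)\<^sup>2 / 2 \<le> l * ln l - l * ln m - l + m"
proof (cases "l = 0 \<or> l = m")
  case True
  moreover have "m\<^sup>2 \<le> m" using assms by (simp add: power2_eq_square mult_left_le)
  ultimately show ?thesis using assms by auto
next
  case False
  then have pos: "0 < l" "0 < m" "l \<noteq> m" using assms by (auto simp: less_le)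
  define g where "g x = x * ln x - x * ln m - x + m - (x - m)\<^sup>2 / 2" for x
  have der: "(g has_real_derivative ln x - ln m - (x - m)) (at x)" if "x > 0" for x
    unfolding g_def using that by (auto intro!: derivative_eq_intros simp: field_simps)
  \<comment> \<open>From \<open>ln y \<le> y - 1\<close> at y = r / s, and 1 - r / s = (s - r) / s
    >= s - r.\<close>
  have mono: "s - r \<le> ln s - ln r" if "0 < r" "r \<le> s" "s \<le> 1" for r s :: real
  proof -
    have "ln (r / s) \<le> r / s - 1" using that by (intro ln_le_minus_one) auto
    moreover have "(s - r) * s \<le> s - r" using that by (simp add: mult_left_le)
    then have "s - r \<le> 1 - r / s" using that by (simp add: field_simps)
    ultimately show ?thesis using that by (simp add: ln_div)
  qed
  have "g m \<le> g l"
  proof (cases "m < l")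
    case True
    then obtain z where "m < z" "z < l" "g l - g m = (l - m) * (ln z - ln m - (z - m))"
      using MVT2[of m l g "\<lambda>x. ln x - ln m - (x - m)"] der pos by force
    then show ?thesis
      using mono[of m z] pos assms mult_nonneg_nonneg[of "l - m" "ln z - ln m - (z - m)"] by linarith
  next
    case False
    then have "l < m" using pos by simp
    then obtain z where "l < z" "z < m" "g m - g l = (m - l) * (ln z - ln m - (z - m))"
      using MVT2[of l m g "\<lambda>x. ln x - ln m - (x - m)"] der pos by force
    then show ?thesis
      using mono[of z m] pos assms mult_nonneg_nonpos[of "m - l" "ln z - ln m - (z - m)"] by linarith
  qed
  then show ?thesis by (simp add: g_def)
qed

lemma inner_fcalc_fcalc:
  "fcalc f a \<bullet> fcalc g b =
    (\<Sum>l\<in>eigvals a. \<Sum>m\<in>eigvals b. f l * g m * (eigenprojection a l \<bullet> eigenprojection b m))"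
  unfolding fcalc_def inner_sum_left
  by (intro sum.cong refl) (simp add: inner_sum_right sum_distrib_left mult_ac)

text \<open>The scalar inequality is summed over pairs of eigenvalues with the nonnegative weights
  tr(E_l F_m), which also covers noncommuting states. Either family of projections sums to the
  identity, so terms in one eigenvalue alone turn into traces.\<close>

lemma klein:
  assumes \<rho>: "\<rho> \<in> state_space A" and \<sigma>: "\<sigma> \<in> state_space A" and ker: "mker \<sigma> \<subseteq> mker \<rho>"
  shows "(norm (\<rho> - \<sigma>))\<^sup>2 / 2 \<le> \<rho> \<bullet> fcalc ln \<rho> - \<rho> \<bullet> fcalc ln \<sigma>"
proof -
  note h = state_hermitian[OF \<rho>] state_hermitian[OF \<sigma>]
  define w where "w l m = eigenprojection \<rho> l \<bullet> eigenprojection \<sigma> m" for l m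
  define D where "D f = (\<Sum>l\<in>eigvals \<rho>. \<Sum>m\<in>eigvals \<sigma>. f l m * w l m)" for f
  have D: "D (\<lambda>l m. f l * g m) = fcalc f \<rho> \<bullet> fcalc g \<sigma>" for f g
    by (simp add: D_def w_def inner_fcalc_fcalc)
  have D_left: "D (\<lambda>l m. f l) = mat 1 \<bullet> fcalc f \<rho>" for f
    using D[of f "\<lambda>_. 1"] h by (simp add: fcalc_1 inner_commute)
  have D_right: "D (\<lambda>l m. g m) = mat 1 \<bullet> fcalc g \<sigma>" for g
    using D[of "\<lambda>_. 1" g] h by (simp add: fcalc_1)
  have D_le: "D f \<le> D g" if "\<And>l m. l \<in> eigvals \<rho> \<Longrightarrow> m \<in> eigvals \<sigma> \<Longrightarrow> w l m \<noteq> 0 \<Longrightarrow> f l m \<le> g l m"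
    for f g
    unfolding D_def
  proof (intro sum_mono)
    fix l m assume "l \<in> eigvals \<rho>" "m \<in> eigvals \<sigma>"
    then show "f l m * w l m \<le> g l m * w l m"
      using that[of l m] inner_two_eigenprojections_nonneg[of \<rho> l \<sigma> m]
      by (cases "w l m = 0") (auto simp: w_def intro: mult_right_mono)
  qed
  have D_diff: "D (\<lambda>l m. f l m - g l m) = D f - D g" for f g
    by (simp add: D_def left_diff_distrib sum_subtractf)
  have D_add: "D (\<lambda>l m. f l m + g l m) = D f + D g" for f g
    by (simp add: D_def distrib_right sum.distrib)
  have D_scale: "D (\<lambda>l m. c * f l m) = c * D f" for c f
    by (simp add: D_def sum_distrib_left mult.assoc)
  \<comment> \<open>Excludes the pairs l > 0, m = 0, to which the scalar inequality does not apply: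
    \<open>\<rho>\<close> annihilates the kernel of \<open>\<sigma>\<close>.\<close>
  have w0: "l = 0" if "w l 0 \<noteq> 0" for l
  proof (rule ccontr)
    assume "l \<noteq> 0"
    have "l * w l 0 = (\<rho> ** eigenprojection \<rho> l) \<bullet> eigenprojection \<sigma> 0"
      by (simp add: w_def mult_eigenprojection)
    also have "\<dots> = 0"
      by (simp add: inner_matrix_mult_left h mult_eigenprojection_0[OF ker])
    finally show False using that \<open>l \<noteq> 0\<close> by simp
  qed
  have sq: "mat 1 \<bullet> fcalc (\<lambda>x. x * x) a = a \<bullet> a" if "mat_adjoint a = a" for a :: "complex^'a^'a"
    using inner_fcalc_self[OF that, of "\<lambda>x. x"] that by (simp add: fcalc_id)
  have "D (\<lambda>l m. (1/2) * (l * l - 2 * (l * m) + m * m)) \<le> D (\<lambda>l m. l * ln l - l * ln m - l + m)"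
  proof (rule D_le)
    fix l m assume "l \<in> eigvals \<rho>" "m \<in> eigvals \<sigma>" "w l m \<noteq> 0"
    then have "(l - m)\<^sup>2 / 2 \<le> l * ln l - l * ln m - l + m"
      using state_eigvals[OF \<rho>] state_eigvals[OF \<sigma>] w0[of l] by (intro klein_scalar) auto
    then show "(1/2) * (l * l - 2 * (l * m) + m * m) \<le> l * ln l - l * ln m - l + m"
      by (simp add: power2_eq_square field_simps)
  qed
  \<comment> \<open>The contributions of -l and m cancel because both states have trace 1.\<close>
  also have "D (\<lambda>l m. l * ln l - l * ln m - l + m) = \<rho> \<bullet> fcalc ln \<rho> - \<rho> \<bullet> fcalc ln \<sigma>"
    unfolding D_diff D_add D D_left D_right
    using h \<rho> \<sigma> by (simp add: fcalc_id state_inner_1 inner_fcalc_self)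
  also have "D (\<lambda>l m. (1/2) * (l * l - 2 * (l * m) + m * m)) = (norm (\<rho> - \<sigma>))\<^sup>2 / 2"
    unfolding D_scale D_diff D_add D D_left D_right sq[OF h(1)] sq[OF h(2)]
    using h by (simp add: fcalc_id power2_norm_eq_inner inner_diff inner_commute)
  finally show ?thesis .
qed

lemma rel_entropy_ge_norm:
  assumes "\<rho> \<in> state_space A" "\<sigma> \<in> state_space A"
  shows "ereal ((norm (\<rho> - \<sigma>))\<^sup>2 / 2) \<le> rel_entropy \<rho> \<sigma>"
  using klein[OF assms] by (simp add: rel_entropy_state[OF assms])

lemma rel_entropy_self: "\<rho> \<in> state_space A \<Longrightarrow> rel_entropy \<rho> \<rho> = 0"
  by (simp add: rel_entropy_state zero_ereal_def)

subsection \<open>Limits of relative entropies\<close>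

lemma continuous_on_x_ln_x: "continuous_on {0..} (\<lambda>x::real. x * ln x)"
  unfolding continuous_on_def
proof
  fix x :: real assume x: "x \<in> {0..}"
  show "((\<lambda>x. x * ln x) \<longlongrightarrow> x * ln x) (at x within {0..})"
  proof (cases "x = 0")
    case False
    then show ?thesis using x by (intro tendsto_intros) auto
  next
    case True
    \<comment> \<open>From \<open>ln y \<le> y - 1\<close> at y = 1 / sqrt t; passing to the square
      root leaves a bound that still tends to 0.\<close>
    have bound: "norm (t * ln t) \<le> 2 * sqrt t" if t: "0 < t" "t < 1" for t :: real
    proof -
      have "ln (1 / sqrt t) \<le> 1 / sqrt t" using ln_le_minus_one[of "1 / sqrt t"] t by simp
      then have "- ln t \<le> 2 / sqrt t" using t by (simp add: ln_div ln_sqrt)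
      then have "t * (- ln t) \<le> t * (2 / sqrt t)" by (rule mult_left_mono) (use t in simp)
      also have "t * (2 / sqrt t) = 2 * sqrt t" using t by (simp add: field_simps)
      finally show ?thesis using t by (simp add: abs_mult)
    qed
    have "\<forall>\<^sub>F t in at 0 within {0..}. norm (t * ln t) \<le> 2 * sqrt t"
      unfolding eventually_at
      by (rule exI[of _ 1]) (use bound in \<open>auto simp: dist_real_def\<close>)
    moreover have "((\<lambda>t. 2 * sqrt t) \<longlongrightarrow> 2 * sqrt 0) (at 0 within {0..})"
      by (intro tendsto_intros)
    ultimately have "((\<lambda>t::real. t * ln t) \<longlongrightarrow> 0) (at 0 within {0..})"
      by (simp add: Lim_null_comparison)
    then show ?thesis unfolding True by simp
  qed
qed

context
  fixes A :: "(complex^'n^'n) set" and x :: "nat \<Rightarrow> complex^'n^'n" and \<sigma> :: "complex^'n^'n"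
  assumes x: "\<And>i. x i \<in> state_space A" and \<sigma>: "\<sigma> \<in> state_space A"
begin

lemma tendsto_self_entropy:
  assumes lim: "x \<longlonglongrightarrow> \<sigma>" shows "(\<lambda>i. x i \<bullet> fcalc ln (x i)) \<longlonglongrightarrow> \<sigma> \<bullet> fcalc ln \<sigma>"
proof -
  have "(\<lambda>i. mat 1 \<bullet> fcalc (\<lambda>t. t * ln t) (x i)) \<longlonglongrightarrow> mat 1 \<bullet> fcalc (\<lambda>t. t * ln t) \<sigma>"
    by (intro tendsto_inner tendsto_const tendsto_fcalc_state[OF lim \<sigma> x]
        continuous_on_subset[OF continuous_on_x_ln_x]) auto
  then show ?thesis by (simp add: inner_fcalc_self state_hermitian[OF x] state_hermitian[OF \<sigma>])
qed

lemma tendsto_rel_entropy_left: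
  assumes lim: "x \<longlonglongrightarrow> \<sigma>" and \<rho>: "\<rho> \<in> state_space A" and ker: "mker \<rho> \<subseteq> mker \<sigma>"
    and ev: "\<forall>\<^sub>F i in sequentially. mker \<rho> \<subseteq> mker (x i)"
  shows "(\<lambda>i. rel_entropy (x i) \<rho>) \<longlonglongrightarrow> rel_entropy \<sigma> \<rho>"
proof -
  have "(\<lambda>i. ereal (x i \<bullet> fcalc ln (x i) - x i \<bullet> fcalc ln \<rho>))
      \<longlonglongrightarrow> ereal (\<sigma> \<bullet> fcalc ln \<sigma> - \<sigma> \<bullet> fcalc ln \<rho>)"
    by (intro tendsto_ereal tendsto_diff tendsto_inner tendsto_self_entropy lim tendsto_const)
  moreover have "\<forall>\<^sub>F i in sequentially.
      ereal (x i \<bullet> fcalc ln (x i) - x i \<bullet> fcalc ln \<rho>) = rel_entropy (x i) \<rho>"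
    using ev by eventually_elim (simp add: rel_entropy_state[OF x \<rho>])
  ultimately have "(\<lambda>i. rel_entropy (x i) \<rho>)
      \<longlonglongrightarrow> ereal (\<sigma> \<bullet> fcalc ln \<sigma> - \<sigma> \<bullet> fcalc ln \<rho>)"
    by (rule Lim_transform_eventually)
  then show ?thesis using ker by (simp add: rel_entropy_state[OF \<sigma> \<rho>])
qed

text \<open>A vector of \<open>mker \<rho>\<close> outside the kernel of the limit is outside the
  kernels of almost all terms.\<close>

lemma tendsto_rel_entropy_left_infinity:
  assumes lim: "x \<longlonglongrightarrow> \<sigma>" and \<rho>: "\<rho> \<in> state_space A" and ker: "\<not> mker \<rho> \<subseteq> mker \<sigma>"
  shows "(\<lambda>i. rel_entropy (x i) \<rho>) \<longlonglongrightarrow> \<infinity>"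
proof -
  obtain v where v: "v \<in> mker \<rho>" "\<sigma> *v v \<noteq> 0" using ker by (auto simp: mker_def)
  have "(\<lambda>i. x i *v v) \<longlonglongrightarrow> \<sigma> *v v" by (intro mv.tendsto lim tendsto_const)
  then have "\<forall>\<^sub>F i in sequentially. x i *v v \<noteq> 0"
    using v(2) by (rule tendsto_imp_eventually_ne)
  then have "\<forall>\<^sub>F i in sequentially. rel_entropy (x i) \<rho> = \<infinity>"
  proof eventually_elim
    case (elim i)
    then have "\<not> mker \<rho> \<subseteq> mker (x i)" using v(1) by (auto simp: mker_def)
    then show ?case by (simp add: rel_entropy_state[OF x \<rho>])
  qed
  then show ?thesis by (rule tendsto_eventually)
qed

text \<open>Replacing \<open>ln\<close> by its truncation \<open>ln (max t d)\<close> makes the functional calculus continuous.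
  The difference, the tail, is nonnegative except at \<open>t = 0\<close>, where the spectral weight
  \<open>\<rho> \<bullet> eigenprojection (x i) 0\<close> vanishes. It alone decides about convergence.\<close>

abbreviation (input) "tail d \<equiv> (\<lambda>t::real. ln (max t d) - ln t)"

lemma tendsto_ln_iff_tail:
  assumes lim: "x \<longlonglongrightarrow> \<sigma>" and ker: "mker \<sigma> \<subseteq> mker \<rho>"
    and d: "d > 0" "\<And>l. l \<in> eigvals \<sigma> \<Longrightarrow> l \<noteq> 0 \<Longrightarrow> d \<le> l"
  shows "(\<lambda>i. \<rho> \<bullet> fcalc ln (x i)) \<longlonglongrightarrow> \<rho> \<bullet> fcalc ln \<sigma> \<longleftrightarrow>
    (\<lambda>i. \<rho> \<bullet> fcalc (tail d) (x i)) \<longlonglongrightarrow> 0"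
proof -
  \<comment> \<open>No nonzero eigenvalue of \<open>\<sigma>\<close> is truncated, and
    \<open>\<rho>\<close> has no weight at 0.\<close>
  have "\<rho> \<bullet> fcalc (tail d) \<sigma> = 0"
    unfolding inner_fcalc
  proof (rule sum.neutral, rule ballI)
    fix l assume "l \<in> eigvals \<sigma>"
    then show "tail d l * (\<rho> \<bullet> eigenprojection \<sigma> l) = 0"
      using d(2)[of l] inner_eigenprojection_0[OF ker] by (cases "l = 0") (auto simp: max_def)
  qed
  then have eq: "\<rho> \<bullet> fcalc ln \<sigma> = \<rho> \<bullet> fcalc (\<lambda>t. ln (max t d)) \<sigma>"
    by (simp add: fcalc_diff inner_diff_right)
  have L: "(\<lambda>i. \<rho> \<bullet> fcalc (\<lambda>t. ln (max t d)) (x i)) \<longlonglongrightarrow> \<rho> \<bullet> fcalc ln \<sigma>"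
    unfolding eq using d(1)
    by (intro tendsto_inner tendsto_const tendsto_fcalc_state[OF lim \<sigma> x] continuous_intros) auto
  show ?thesis
  proof
    assume "(\<lambda>i. \<rho> \<bullet> fcalc ln (x i)) \<longlonglongrightarrow> \<rho> \<bullet> fcalc ln \<sigma>"
    from tendsto_diff[OF L this] show "(\<lambda>i. \<rho> \<bullet> fcalc (tail d) (x i)) \<longlonglongrightarrow> 0"
      by (simp add: fcalc_diff inner_diff_right)
  next
    assume "(\<lambda>i. \<rho> \<bullet> fcalc (tail d) (x i)) \<longlonglongrightarrow> 0"
    from tendsto_diff[OF L this] show "(\<lambda>i. \<rho> \<bullet> fcalc ln (x i)) \<longlonglongrightarrow> \<rho> \<bullet> fcalc ln \<sigma>"
      by (simp add: fcalc_diff inner_diff_right)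
  qed
qed

lemma tail_nonneg: "l \<in> eigvals (x i) \<Longrightarrow> l \<noteq> 0 \<Longrightarrow> 0 \<le> tail d l"
  using state_eigvals[OF x[of i]] by (force simp: max_def)

lemma tendsto_rel_entropy_right_iff:
  assumes \<rho>: "\<rho> \<in> state_space A" and ker: "mker \<sigma> \<subseteq> mker \<rho>"
    and ev: "\<forall>\<^sub>F i in sequentially. mker (x i) \<subseteq> mker \<rho>"
  shows "(\<lambda>i. rel_entropy \<rho> (x i)) \<longlonglongrightarrow> rel_entropy \<rho> \<sigma> \<longleftrightarrow>
    (\<lambda>i. \<rho> \<bullet> fcalc ln (x i)) \<longlonglongrightarrow> \<rho> \<bullet> fcalc ln \<sigma>"
proof -
  have "(\<lambda>i. rel_entropy \<rho> (x i)) \<longlonglongrightarrow> rel_entropy \<rho> \<sigma> \<longleftrightarrow>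
    (\<lambda>i. ereal (\<rho> \<bullet> fcalc ln \<rho> - \<rho> \<bullet> fcalc ln (x i))) \<longlonglongrightarrow> rel_entropy \<rho> \<sigma>"
    by (rule tendsto_cong, use ev in eventually_elim) (simp add: rel_entropy_state[OF \<rho> x])
  also have "\<dots> \<longleftrightarrow> (\<lambda>i. \<rho> \<bullet> fcalc ln \<rho> - \<rho> \<bullet> fcalc ln (x i)) \<longlonglongrightarrow> \<rho> \<bullet> fcalc ln \<rho> - \<rho> \<bullet> fcalc ln \<sigma>"
    using ker by (simp add: rel_entropy_state[OF \<rho> \<sigma>])
  also have "\<dots> \<longleftrightarrow> (\<lambda>i. \<rho> \<bullet> fcalc ln (x i)) \<longlonglongrightarrow> \<rho> \<bullet> fcalc ln \<sigma>"
    using tendsto_diff[OF tendsto_const, of _ _ sequentially "\<rho> \<bullet> fcalc ln \<rho>"] by fastforce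
  finally show ?thesis .
qed

text \<open>\<open>\<rho>\<close> puts positive weight on the kernel of \<open>\<sigma>\<close>.
  Truncating the logarithm from below can only lower a finite relative entropy; the lowered quantity
  is norm continuous in \<open>x i\<close>, and at \<open>\<sigma>\<close> it is as large as desired
  for a small truncation level.\<close>

lemma tendsto_rel_entropy_right_infinity:
  assumes lim: "x \<longlonglongrightarrow> \<sigma>" and \<rho>: "\<rho> \<in> state_space A" and ker: "\<not> mker \<sigma> \<subseteq> mker \<rho>"
  shows "(\<lambda>i. rel_entropy \<rho> (x i)) \<longlonglongrightarrow> \<infinity>"
  unfolding tendsto_PInfty
proof
  fix r :: real
  define w where "w = \<rho> \<bullet> eigenprojection \<sigma> 0"
  have w: "w > 0"
  proof -
    have "w \<ge> 0"
      unfolding w_def inner_eigenprojection_column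
      by (intro sum_nonneg psd_nonneg state_psd[OF \<rho>])
    moreover have "w \<noteq> 0"
    proof
      assume "w = 0"
      then have z: "column j (eigenprojection \<sigma> 0) \<in> mker \<rho>" for j
        unfolding w_def inner_eigenprojection_column
        by (subst (asm) sum_nonneg_eq_0_iff)
          (auto intro: psd_nonneg psd_form_zero state_psd[OF \<rho>])
      have "\<rho> ** eigenprojection \<sigma> 0 = 0"
        using z by (simp add: vec_eq_iff column_def mker_def matrix_matrix_mult_def
            matrix_vector_mult_def)
      then have "\<rho> *v v = 0" if "v \<in> mker \<sigma>" for v
        using that eigenprojection_fix[of v \<sigma> 0]
        by (metis (mono_tags, lifting) eigenspace_def matrix_vector_mul_assoc mem_Collect_eq
            mker_def mv.zero_left scaleR_zero_left)
      then show False using ker by (auto simp: mker_def)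
    qed
    ultimately show ?thesis by simp
  qed
  \<comment> \<open>Solves \<open>\<rho> \<bullet> fcalc ln \<rho> - c * w = r + 1\<close>, so
    \<open>ln d \<le> c\<close> suffices. The cap \<open>d \<le> 1\<close> makes the truncated
    logarithm nonpositive on {0..1}, so that the other eigenvalues only help.\<close>
  define c where "c = (\<rho> \<bullet> fcalc ln \<rho> - r - 1) / w"
  define d where "d = min 1 (exp c)"
  have d: "0 < d" "d \<le> 1" "ln d \<le> c" by (auto simp: d_def min_def)
  let ?L = "\<lambda>t. ln (max t d)"
  have L_le: "\<rho> \<bullet> fcalc ?L \<sigma> \<le> ln d * w"
  proof -
    have "\<rho> \<bullet> fcalc ?L \<sigma> \<le> (\<Sum>l\<in>eigvals \<sigma>. if l = 0 then ln d * w else 0)"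
      unfolding inner_fcalc
    proof (rule sum_mono)
      fix l assume "l \<in> eigvals \<sigma>"
      moreover have "0 \<le> \<rho> \<bullet> eigenprojection \<sigma> l"
        unfolding inner_eigenprojection_column
        by (intro sum_nonneg psd_nonneg state_psd[OF \<rho>])
      ultimately show "?L l * (\<rho> \<bullet> eigenprojection \<sigma> l) \<le> (if l = 0 then ln d * w else 0)"
        using d state_eigvals[OF \<sigma>] by (auto simp: w_def intro!: mult_nonpos_nonneg)
    qed
    also have "\<dots> = ln d * w"
    proof -
      have "0 \<in> eigvals \<sigma>"
        using w eigenprojection_not_eigval[of 0 \<sigma>] by (fastforce simp: w_def)
      then show ?thesis by (simp add: finite_eigvals state_hermitian[OF \<sigma>])
    qed
    finally show ?thesis .
  qed
  have "(\<lambda>i. \<rho> \<bullet> fcalc ln \<rho> - \<rho> \<bullet> fcalc ?L (x i)) \<longlonglongrightarrow> \<rho> \<bullet> fcalc ln \<rho> - \<rho> \<bullet> fcalc ?L \<sigma>"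
    using d by (intro tendsto_diff tendsto_const tendsto_inner
        tendsto_fcalc_state[OF lim \<sigma> x] continuous_intros) auto
  moreover have "ln d * w \<le> \<rho> \<bullet> fcalc ln \<rho> - r - 1"
    using mult_right_mono[OF d(3), of w] w by (simp add: c_def)
  then have "r < \<rho> \<bullet> fcalc ln \<rho> - \<rho> \<bullet> fcalc ?L \<sigma>" using L_le by linarith
  ultimately have "\<forall>\<^sub>F i in sequentially. r < \<rho> \<bullet> fcalc ln \<rho> - \<rho> \<bullet> fcalc ?L (x i)"
    by (rule order_tendstoD)
  then show "\<forall>\<^sub>F i in sequentially. ereal r < rel_entropy \<rho> (x i)"
  proof eventually_elim
    case (elim i)
    show ?case
    proof (cases "mker (x i) \<subseteq> mker \<rho>")
      case True
      have "0 \<le> \<rho> \<bullet> fcalc (tail d) (x i)"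
        using True tail_nonneg by (intro inner_fcalc_nonneg state_psd[OF \<rho>])
      then show ?thesis
        using elim True by (simp add: rel_entropy_state[OF \<rho> x] fcalc_diff inner_diff_right)
    qed (simp add: rel_entropy_state[OF \<rho> x])
  qed
qed

lemma tendsto_norm_if_rel_entropy:
  assumes "(\<lambda>i. rel_entropy \<sigma> (x i)) \<longlonglongrightarrow> 0 \<or> (\<lambda>i. rel_entropy (x i) \<sigma>) \<longlonglongrightarrow> 0"
  shows "x \<longlonglongrightarrow> \<sigma>"
proof -
  have "(\<lambda>i. ereal ((norm (x i - \<sigma>))\<^sup>2 / 2)) \<longlonglongrightarrow> 0"
    using assms
  proof
    assume *: "(\<lambda>i. rel_entropy \<sigma> (x i)) \<longlonglongrightarrow> 0"
    show ?thesis
      by (rule tendsto_sandwich[OF _ _ tendsto_const *])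
        (use rel_entropy_ge_norm[OF \<sigma> x] in \<open>auto simp: norm_minus_commute\<close>)
  next
    assume *: "(\<lambda>i. rel_entropy (x i) \<sigma>) \<longlonglongrightarrow> 0"
    show ?thesis
      by (rule tendsto_sandwich[OF _ _ tendsto_const *])
        (use rel_entropy_ge_norm[OF x \<sigma>] in auto)
  qed
  then have "(\<lambda>i. (norm (x i - \<sigma>))\<^sup>2 / 2) \<longlonglongrightarrow> 0"
    by (simp add: zero_ereal_def)
  then have "(\<lambda>i. sqrt (2 * ((norm (x i - \<sigma>))\<^sup>2 / 2))) \<longlonglongrightarrow> sqrt (2 * 0)"
    by (intro tendsto_intros)
  then have "(\<lambda>i. norm (x i - \<sigma>)) \<longlonglongrightarrow> 0" by simp
  then show ?thesis by (simp add: tendsto_norm_zero_iff LIM_zero_iff)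
qed

text \<open>Domination bounds the tail weighted by \<open>\<sigma>\<close> by a multiple of the tail
  of \<open>x i\<close> weighted by \<open>x i\<close> itself. The latter is the trace of the
  continuous function t * tail d t, and it vanishes at the limit.\<close>

lemma tendsto_rel_entropy_right_if_dominated:
  assumes lim: "x \<longlonglongrightarrow> \<sigma>"
    and ev: "\<forall>\<^sub>F i in sequentially. \<forall>v. v \<bullet> (\<sigma> *v v) \<le> c * (v \<bullet> (x i *v v))"
  shows "(\<lambda>i. rel_entropy \<sigma> (x i)) \<longlonglongrightarrow> 0"
proof -
  obtain d where d: "d > 0" "\<And>l. l \<in> eigvals \<sigma> \<Longrightarrow> l \<noteq> 0 \<Longrightarrow> d \<le> l"
    using psd_least_positive_eigval[OF state_psd[OF \<sigma>]] by blast
  have ker: "\<forall>\<^sub>F i in sequentially. mker (x i) \<subseteq> mker \<sigma>"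
    using ev by eventually_elim (rule mker_antimono_form[OF state_psd[OF x] state_psd[OF \<sigma>]], blast)
  have cont: "continuous_on {0..1} (\<lambda>t. t * tail d t)"
  proof -
    have "continuous_on {0..1} (\<lambda>t. t * ln (max t d) - t * ln t)"
      using d(1) by (intro continuous_intros continuous_on_subset[OF continuous_on_x_ln_x]) auto
    then show ?thesis by (simp add: right_diff_distrib)
  qed
  have "(\<lambda>i. c * (x i \<bullet> fcalc (tail d) (x i))) \<longlonglongrightarrow> c * (\<sigma> \<bullet> fcalc (tail d) \<sigma>)"
    unfolding inner_fcalc_self[OF state_hermitian[OF x]] inner_fcalc_self[OF state_hermitian[OF \<sigma>]]
    by (intro tendsto_mult_left tendsto_inner tendsto_const tendsto_fcalc_state[OF lim \<sigma> x] cont)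
  also have "\<sigma> \<bullet> fcalc (tail d) \<sigma> = mat 1 \<bullet> fcalc (\<lambda>t. t * tail d t) \<sigma>"
    by (rule inner_fcalc_self[OF state_hermitian[OF \<sigma>]])
  also have "fcalc (\<lambda>t. t * tail d t) \<sigma> = fcalc (\<lambda>_. 0) \<sigma>"
  proof (rule fcalc_cong)
    fix l assume "l \<in> eigvals \<sigma>"
    then show "l * tail d l = 0" using d(2)[of l] by (cases "l = 0") (auto simp: max_def)
  qed
  finally have upper: "(\<lambda>i. c * (x i \<bullet> fcalc (tail d) (x i))) \<longlonglongrightarrow> 0"
    by (simp add: fcalc_def)
  have "(\<lambda>i. \<sigma> \<bullet> fcalc (tail d) (x i)) \<longlonglongrightarrow> 0"
  proof (rule tendsto_sandwich[OF _ _ tendsto_const upper])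
    show "\<forall>\<^sub>F i in sequentially. 0 \<le> \<sigma> \<bullet> fcalc (tail d) (x i)"
      using ker by eventually_elim (use tail_nonneg in \<open>intro inner_fcalc_nonneg state_psd[OF \<sigma>]\<close>)
    show "\<forall>\<^sub>F i in sequentially. \<sigma> \<bullet> fcalc (tail d) (x i) \<le> c * (x i \<bullet> fcalc (tail d) (x i))"
      using ev ker
    proof eventually_elim
      case (elim i)
      then show ?case by (intro inner_fcalc_mono tail_nonneg) auto
    qed
  qed
  then have "(\<lambda>i. \<sigma> \<bullet> fcalc ln (x i)) \<longlonglongrightarrow> \<sigma> \<bullet> fcalc ln \<sigma>"
    using tendsto_ln_iff_tail[OF lim order_refl d] by blast
  then show ?thesis
    using tendsto_rel_entropy_right_iff[OF \<sigma> order_refl ker] rel_entropy_self[OF \<sigma>] by simp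
qed

lemma eventually_not_infinity:
  assumes "f \<longlonglongrightarrow> 0"
  shows "\<forall>\<^sub>F i in sequentially. f i \<noteq> (\<infinity>::ereal)"
  using order_tendstoD(2)[OF assms, of \<infinity>] by (auto elim: eventually_mono)

lemma rel_entropy_right_continuous:
  assumes 0: "(\<lambda>i. rel_entropy \<sigma> (x i)) \<longlonglongrightarrow> 0" and \<rho>: "\<rho> \<in> state_space A"
  shows "(\<lambda>i. rel_entropy \<rho> (x i)) \<longlonglongrightarrow> rel_entropy \<rho> \<sigma>"
proof (cases "mker \<sigma> \<subseteq> mker \<rho>")
  case False
  have "x \<longlonglongrightarrow> \<sigma>" using 0 by (intro tendsto_norm_if_rel_entropy) simp
  from tendsto_rel_entropy_right_infinity[OF this \<rho> False] False show ?thesis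
    by (simp add: rel_entropy_state[OF \<rho> \<sigma>])
next
  case ker: True
  have lim: "x \<longlonglongrightarrow> \<sigma>" using 0 by (intro tendsto_norm_if_rel_entropy) simp
  obtain d where d: "d > 0" "\<And>l. l \<in> eigvals \<sigma> \<Longrightarrow> l \<noteq> 0 \<Longrightarrow> d \<le> l"
    using psd_least_positive_eigval[OF state_psd[OF \<sigma>]] by blast
  have ev: "\<forall>\<^sub>F i in sequentially. mker (x i) \<subseteq> mker \<sigma>"
    using eventually_not_infinity[OF 0]
    by eventually_elim (simp add: rel_entropy_state[OF \<sigma> x] split: if_splits)
  have "(\<lambda>i. \<sigma> \<bullet> fcalc ln (x i)) \<longlonglongrightarrow> \<sigma> \<bullet> fcalc ln \<sigma>"
    using tendsto_rel_entropy_right_iff[OF \<sigma> order_refl ev] 0 rel_entropy_self[OF \<sigma>] by simp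
  then have tail: "(\<lambda>i. \<sigma> \<bullet> fcalc (tail d) (x i)) \<longlonglongrightarrow> 0"
    using tendsto_ln_iff_tail[OF lim order_refl d] by blast
  obtain k where k: "\<And>b v. mat_adjoint b = b \<Longrightarrow> mker \<sigma> \<subseteq> mker b \<Longrightarrow>
      \<bar>v \<bullet> (b *v v)\<bar> \<le> k * norm b * (v \<bullet> (\<sigma> *v v))"
    using form_bounded_by_psd[OF state_psd[OF \<sigma>]] by blast
  \<comment> \<open>A comparison of two fixed states; it carries the vanishing of the tail from the
    weight \<open>\<sigma>\<close> over to the weight \<open>\<rho>\<close>.\<close>
  have dom: "v \<bullet> (\<rho> *v v) \<le> k * norm \<rho> * (v \<bullet> (\<sigma> *v v))" for v
    using k[OF state_hermitian[OF \<rho>] ker, of v] by linarith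
  have ev': "\<forall>\<^sub>F i in sequentially. mker (x i) \<subseteq> mker \<rho>"
    using ev by eventually_elim (use ker in blast)
  have upper: "(\<lambda>i. k * norm \<rho> * (\<sigma> \<bullet> fcalc (tail d) (x i))) \<longlonglongrightarrow> 0"
    using tendsto_mult_left[OF tail, of "k * norm \<rho>"] by simp
  have "(\<lambda>i. \<rho> \<bullet> fcalc (tail d) (x i)) \<longlonglongrightarrow> 0"
  proof (rule tendsto_sandwich[OF _ _ tendsto_const upper])
    show "\<forall>\<^sub>F i in sequentially. 0 \<le> \<rho> \<bullet> fcalc (tail d) (x i)"
      using ev' by eventually_elim (use tail_nonneg in \<open>intro inner_fcalc_nonneg state_psd[OF \<rho>]\<close>)
    show "\<forall>\<^sub>F i in sequentially.
        \<rho> \<bullet> fcalc (tail d) (x i) \<le> k * norm \<rho> * (\<sigma> \<bullet> fcalc (tail d) (x i))"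
      using ev ev' by eventually_elim (intro inner_fcalc_mono tail_nonneg dom)
  qed
  then have "(\<lambda>i. \<rho> \<bullet> fcalc ln (x i)) \<longlonglongrightarrow> \<rho> \<bullet> fcalc ln \<sigma>"
    using tendsto_ln_iff_tail[OF lim ker d] by blast
  then show ?thesis using tendsto_rel_entropy_right_iff[OF \<rho> ker ev'] by simp
qed

section \<open>Consequences of I-convergence\<close>

lemma eventually_mker_subset:
  assumes "(\<lambda>i. rel_entropy (x i) \<sigma>) \<longlonglongrightarrow> 0"
  shows "\<forall>\<^sub>F i in sequentially. mker \<sigma> \<subseteq> mker (x i)"
  using eventually_not_infinity[OF assms]
  by eventually_elim (simp add: rel_entropy_state[OF x \<sigma>] split: if_splits)

lemma rel_entropy_left_continuous:
  assumes 0: "(\<lambda>i. rel_entropy (x i) \<sigma>) \<longlonglongrightarrow> 0" and \<rho>: "\<rho> \<in> state_space A"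
  shows "(\<lambda>i. rel_entropy (x i) \<rho>) \<longlonglongrightarrow> rel_entropy \<sigma> \<rho>"
proof -
  have lim: "x \<longlonglongrightarrow> \<sigma>" using 0 by (intro tendsto_norm_if_rel_entropy) simp
  show ?thesis
  proof (cases "mker \<rho> \<subseteq> mker \<sigma>")
    case True
    have "\<forall>\<^sub>F i in sequentially. mker \<rho> \<subseteq> mker (x i)"
      using eventually_mker_subset[OF 0] by eventually_elim (use True in blast)
    then show ?thesis by (rule tendsto_rel_entropy_left[OF lim \<rho> True])
  next
    case False
    with tendsto_rel_entropy_left_infinity[OF lim \<rho>] show ?thesis
      by (simp add: rel_entropy_state[OF \<sigma> \<rho>])
  qed
qed

text \<open>\<open>\<sigma> - x i\<close> vanishes on the kernel of \<open>\<sigma>\<close> and is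
  small in norm. Below the threshold 1 / (2 k) the form bound makes its form at most half that of
  \<open>\<sigma>\<close>, whence the constant 2.\<close>

lemma eventually_dominated:
  assumes lim: "x \<longlonglongrightarrow> \<sigma>" and ev: "\<forall>\<^sub>F i in sequentially. mker \<sigma> \<subseteq> mker (x i)"
  shows "\<forall>\<^sub>F i in sequentially. \<forall>v. v \<bullet> (\<sigma> *v v) \<le> 2 * (v \<bullet> (x i *v v))"
proof -
  obtain k where k: "k > 0" "\<And>b v. mat_adjoint b = b \<Longrightarrow> mker \<sigma> \<subseteq> mker b \<Longrightarrow>
      \<bar>v \<bullet> (b *v v)\<bar> \<le> k * norm b * (v \<bullet> (\<sigma> *v v))"
    using form_bounded_by_psd[OF state_psd[OF \<sigma>]] by blast
  have "\<forall>\<^sub>F i in sequentially. norm (x i - \<sigma>) < 1 / (2 * k)"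
    using tendstoD[OF lim, of "1 / (2 * k)"] k(1) by (simp add: dist_norm)
  with ev show ?thesis
  proof eventually_elim
    case (elim i)
    show ?case
    proof
      fix v
      let ?q = "v \<bullet> (\<sigma> *v v)"
      have q: "?q \<ge> 0" by (rule psd_nonneg[OF state_psd[OF \<sigma>]])
      have "mat_adjoint (\<sigma> - x i) = \<sigma> - x i"
        by (simp add: mat_adjoint_linear state_hermitian[OF x] state_hermitian[OF \<sigma>])
      moreover have "mker \<sigma> \<subseteq> mker (\<sigma> - x i)"
        using elim(1) by (auto simp: mker_def mv.diff_left)
      ultimately have "\<bar>v \<bullet> ((\<sigma> - x i) *v v)\<bar> \<le> k * norm (\<sigma> - x i) * ?q"
        by (rule k(2))
      also have "\<dots> \<le> 1 / 2 * ?q"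
        using elim(2) k(1) q
        by (intro mult_right_mono) (auto simp: norm_minus_commute field_simps)
      finally show "?q \<le> 2 * (v \<bullet> (x i *v v))"
        unfolding mv.diff_left inner_diff_right by linarith
    qed
  qed
qed

text \<open>One inclusion is finiteness of the relative entropy, the other follows from
  domination.\<close>

lemma eventually_mker_eq:
  assumes "(\<lambda>i. rel_entropy (x i) \<sigma>) \<longlonglongrightarrow> 0"
  shows "\<forall>\<^sub>F i in sequentially. mker (x i) = mker \<sigma>"
proof -
  note ker = eventually_mker_subset[OF assms]
  have "x \<longlonglongrightarrow> \<sigma>" using assms by (intro tendsto_norm_if_rel_entropy) simp
  from eventually_dominated[OF this ker] ker show ?thesis
  proof eventually_elim
    case (elim i)
    then show ?case
      using mker_antimono_form[OF state_psd[OF x] state_psd[OF \<sigma>], of 2 i] by blast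
  qed
qed

lemma rel_entropy_left_imp_right:
  assumes "(\<lambda>i. rel_entropy (x i) \<sigma>) \<longlonglongrightarrow> 0"
  shows "(\<lambda>i. rel_entropy \<sigma> (x i)) \<longlonglongrightarrow> 0"
proof -
  have "x \<longlonglongrightarrow> \<sigma>" using assms by (intro tendsto_norm_if_rel_entropy) simp
  then show ?thesis
    using eventually_dominated eventually_mker_subset[OF assms]
      tendsto_rel_entropy_right_if_dominated by blast
qed

end

subsection \<open>The topology of a divergence\<close>

definition div_conv :: "'a set \<Rightarrow> ('a \<Rightarrow> 'a \<Rightarrow> ereal) \<Rightarrow> 'a convergence" where
  "div_conv X D = {(xs, x). xs \<in> UNIV \<rightarrow> X \<and> x \<in> X \<and> (\<lambda>i. D x (xs i)) \<longlonglongrightarrow> 0}"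

lemma tendsto_0_ereal_iff:
  fixes f :: "nat \<Rightarrow> ereal" assumes "\<And>i. 0 \<le> f i"
  shows "f \<longlonglongrightarrow> 0 \<longleftrightarrow> (\<forall>e>0. \<forall>\<^sub>F i in sequentially. f i < e)"
  unfolding order_tendsto_iff
  using assms by (auto intro: always_eventually less_le_trans)

lemma INF_eq_0_iff:
  fixes f :: "'i \<Rightarrow> ereal" assumes "\<And>i. i \<in> I \<Longrightarrow> 0 \<le> f i"
  shows "(INF i\<in>I. f i) = 0 \<longleftrightarrow> (\<forall>e>0. \<exists>i\<in>I. f i < e)"
proof -
  have "0 \<le> (INF i\<in>I. f i)" using assms by (intro INF_greatest)
  then have "(INF i\<in>I. f i) = 0 \<longleftrightarrow> (\<forall>e>0. (INF i\<in>I. f i) < e)"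
    by (metis less_irrefl order_le_less)
  then show ?thesis by (simp add: INF_less_iff)
qed

lemma tendsto_0_if_less_inverse:
  fixes f :: "nat \<Rightarrow> ereal"
  assumes "\<And>i. 0 \<le> f i" "\<And>i. f i < ereal (inverse (real (Suc i)))"
  shows "f \<longlonglongrightarrow> 0"
proof (rule tendsto_sandwich[OF _ _ tendsto_const])
  show "(\<lambda>i. ereal (inverse (real (Suc i)))) \<longlonglongrightarrow> 0"
    using LIMSEQ_inverse_real_of_nat by (simp add: zero_ereal_def)
qed (use assms in \<open>auto intro!: always_eventually intro: less_imp_le simp del: of_nat_Suc\<close>)

text \<open>\<open>D_cont\<close> stands in for symmetry and the triangle inequality: openness of
  the disks and uniqueness of limits rest on it.\<close>

locale divergence =
  fixes X :: "'a set" and D :: "'a \<Rightarrow> 'a \<Rightarrow> ereal"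
  assumes D_nonneg: "x \<in> X \<Longrightarrow> y \<in> X \<Longrightarrow> 0 \<le> D x y"
    and D_self: "x \<in> X \<Longrightarrow> D x x = 0"
    and D_eq_0: "x \<in> X \<Longrightarrow> y \<in> X \<Longrightarrow> D x y = 0 \<Longrightarrow> x = y"
    and D_cont: "(\<And>i. xs i \<in> X) \<Longrightarrow> x \<in> X \<Longrightarrow> y \<in> X \<Longrightarrow>
      (\<lambda>i. D x (xs i)) \<longlonglongrightarrow> 0 \<Longrightarrow> (\<lambda>i. D y (xs i)) \<longlonglongrightarrow> D y x"
begin

abbreviation "C \<equiv> div_conv X D"
abbreviation "T \<equiv> topology_of_conv X C"

lemma C_iff: "(xs, x) \<in> C \<longleftrightarrow> (\<forall>i. xs i \<in> X) \<and> x \<in> X \<and> (\<lambda>i. D x (xs i)) \<longlonglongrightarrow> 0"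
  by (auto simp: div_conv_def)

lemma conv_on_C: "conv_on X C"
  by (auto simp: conv_on_def div_conv_def)

lemma topspace_T [simp]: "topspace T = X"
  by (rule topspace_topology_of_conv[OF conv_on_C])

lemma C_cont: "(xs, x) \<in> C \<Longrightarrow> y \<in> X \<Longrightarrow> (\<lambda>i. D y (xs i)) \<longlonglongrightarrow> D y x"
  using D_cont by (simp add: C_iff)

text \<open>Observed from \<open>y\<close>, the values \<open>D y (xs i)\<close> tend both to 0 and
  to \<open>D y x\<close>.\<close>

lemma unique_limits_C: "unique_limits C"
  unfolding unique_limits_def
proof (intro allI impI)
  fix xs x y assume x: "(xs, x) \<in> C" and y: "(xs, y) \<in> C"
  then have "(\<lambda>i. D y (xs i)) \<longlonglongrightarrow> 0" "(\<lambda>i. D y (xs i)) \<longlonglongrightarrow> D y x"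
    using C_cont by (auto simp: C_iff)
  then have "D y x = 0" using LIMSEQ_unique by blast
  then show "x = y" using x y D_eq_0 by (auto simp: C_iff)
qed

lemma Lstar_C: "Lstar_conv X C"
  unfolding Lstar_conv_def
proof (intro conjI ballI allI impI)
  fix xs and x assume xs: "xs \<in> UNIV \<rightarrow> X" "x \<in> X" and "(xs, x) \<notin> C"
  then have "\<not> (\<lambda>i. D x (xs i)) \<longlonglongrightarrow> 0" by (auto simp: C_iff)
  then obtain e where e: "e > 0" "\<not> (\<forall>\<^sub>F i in sequentially. D x (xs i) < e)"
    using xs D_nonneg by (subst (asm) tendsto_0_ereal_iff) auto
  \<comment> \<open>The terms outside one fixed disk form a subsequence, and none of its
    subsequences can enter that disk.\<close>
  then have "infinite {i. \<not> D x (xs i) < e}"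
    by (simp add: not_eventually frequently_cofinite cofinite_eq_sequentially[symmetric])
  then obtain r :: "nat \<Rightarrow> nat" where r: "strict_mono r" "\<And>n. r n \<in> {i. \<not> D x (xs i) < e}"
    using infinite_enumerate by blast
  have "(xs \<circ> r \<circ> s, x) \<notin> C" for s :: "nat \<Rightarrow> nat"
  proof
    assume "(xs \<circ> r \<circ> s, x) \<in> C"
    then have "(\<lambda>i. D x (xs (r (s i)))) \<longlonglongrightarrow> 0" by (simp add: C_iff)
    from order_tendstoD(2)[OF this e(1)] have "\<exists>i. D x (xs (r (s i))) < e"
      by (auto simp: eventually_sequentially)
    then show False using r(2) by blast
  qed
  with r(1) show "\<exists>r::nat \<Rightarrow> nat. strict_mono r \<and> (\<forall>s::nat \<Rightarrow> nat. strict_mono s \<longrightarrow> (xs \<circ> r \<circ> s, x) \<notin> C)" by blast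
next
  fix xs x r assume "(xs, x) \<in> C" "strict_mono (r :: nat \<Rightarrow> nat)"
  then show "(xs \<circ> r, x) \<in> C"
    using LIMSEQ_subseq_LIMSEQ[of "\<lambda>i. D x (xs i)" 0 r] by (simp add: C_iff comp_def)
qed (simp_all add: conv_on_C C_iff D_self)

lemma openin_T_preimage:
  assumes "x \<in> X" "open V" shows "openin T {y \<in> X. D x y \<in> V}"
  unfolding openin_topology_of_conv conv_openset_def
proof (intro conjI allI impI)
  fix xs y assume *: "y \<in> {y \<in> X. D x y \<in> V}" "(xs, y) \<in> C"
  then have "\<forall>\<^sub>F i in sequentially. D x (xs i) \<in> V"
    using topological_tendstoD[OF C_cont] assms by blast
  then show "\<forall>\<^sub>F i in sequentially. xs i \<in> {y \<in> X. D x y \<in> V}"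
    using * by (simp add: C_iff)
qed auto

lemma openin_T_disk: "x \<in> X \<Longrightarrow> openin T {y \<in> X. D x y < e}"
  using openin_T_preimage[of x "{..<e}"] by simp

lemma closedin_T_disk:
  assumes "x \<in> X" shows "closedin T {y \<in> X. D x y \<le> e}"
proof -
  have "X - {y \<in> X. D x y \<le> e} = {y \<in> X. D x y \<in> {e<..}}" by auto
  then show ?thesis
    using openin_T_preimage[OF assms, of "{e<..}"] by (auto simp: closedin_def)
qed

lemma conv_continuous_D:
  assumes "x \<in> X" shows "conv_continuous X C {0..\<infinity>} (conv_of_topology ext_topology) (D x)"
  using assms C_cont[of _ _ x] D_nonneg
  by (auto simp: conv_continuous_def conv_of_topology_def ext_topology_def limitin_subtopology
      comp_def C_iff)

lemma continuous_map_D: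
  assumes "x \<in> X" shows "continuous_map T ext_topology (D x)"
  unfolding continuous_map_def
proof (intro conjI allI impI)
  show "D x \<in> topspace T \<rightarrow> topspace ext_topology"
    using assms D_nonneg by (auto simp: ext_topology_def)
  fix U assume "openin ext_topology U"
  then obtain V where V: "open V" "U = {0..\<infinity>} \<inter> V"
    by (auto simp: ext_topology_def openin_open)
  then have "{y \<in> topspace T. D x y \<in> U} = {y \<in> X. D x y \<in> V}"
    using assms D_nonneg by auto
  then show "openin T {y \<in> topspace T. D x y \<in> U}" using openin_T_preimage[OF assms V(1)] by simp
qed

text \<open>Otherwise a point of \<open>Y - U\<close> could be picked in every disk of radius 1 / (n
  + 1), and these points converge to \<open>x\<close>. The form relative to \<open>Y\<close> serves
  \<open>T\<close> and its subspaces alike.\<close>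

lemma conv_openset_includes_disk:
  assumes "Y \<subseteq> X" and U: "conv_openset Y (conv_restrict C Y) U" "x \<in> U"
  shows "\<exists>n. {y \<in> Y. D x y < ereal (inverse (real (Suc n)))} \<subseteq> U"
proof (rule ccontr)
  assume "\<not> ?thesis"
  then have "\<forall>n. \<exists>y. y \<in> Y \<and> D x y < ereal (inverse (real (Suc n))) \<and> y \<notin> U" by blast
  then obtain ys where ys: "\<And>n. ys n \<in> Y \<and> D x (ys n) < ereal (inverse (real (Suc n))) \<and> ys n \<notin> U"
    by metis
  have x: "x \<in> Y" using U by (auto simp: conv_openset_def)
  have "(\<lambda>n. D x (ys n)) \<longlonglongrightarrow> 0"
    using ys D_nonneg[OF subsetD[OF assms(1) x] subsetD[OF assms(1)]]
    by (intro tendsto_0_if_less_inverse) auto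
  then have "(ys, x) \<in> conv_restrict C Y"
    using ys x assms(1) by (auto simp: conv_restrict_def C_iff)
  then have "\<forall>\<^sub>F n in sequentially. ys n \<in> U"
    using U unfolding conv_openset_def by blast
  then show False using ys by (auto simp: eventually_sequentially)
qed

lemma conv_restrict_C: "conv_restrict C X = C"
  by (auto simp: conv_restrict_def div_conv_def)

lemma openin_T_includes_disk:
  assumes "openin T U" "x \<in> U"
  shows "\<exists>n. {y \<in> X. D x y < ereal (inverse (real (Suc n)))} \<subseteq> U"
  using conv_openset_includes_disk[of X U x] assms
  by (simp add: conv_restrict_C openin_topology_of_conv)

lemma base_at_disks:
  assumes "x \<in> X" shows "base_at T x {{y \<in> X. D x y < e} |e. 0 < e}"
  unfolding base_at_def
proof (intro conjI ballI allI impI)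
  fix U assume "openin T U \<and> x \<in> U"
  then obtain n where "{y \<in> X. D x y < ereal (inverse (real (Suc n)))} \<subseteq> U"
    using openin_T_includes_disk by blast
  moreover have "0 < ereal (inverse (real (Suc n)))" by simp
  ultimately show "\<exists>B\<in>{{y \<in> X. D x y < e} |e. 0 < e}. B \<subseteq> U" by blast
qed (use assms openin_T_disk D_self in auto)

lemma first_countable_T: "first_countable T"
  unfolding first_countable_def
proof
  fix x assume "x \<in> topspace T"
  then have x: "x \<in> X" by simp
  let ?B = "range (\<lambda>n. {y \<in> X. D x y < ereal (inverse (real (Suc n)))})"
  have "countable ?B" by simp
  moreover have "\<forall>V\<in>?B. openin T V" using openin_T_disk[OF x] by blast
  moreover have "\<forall>U. openin T U \<and> x \<in> U \<longrightarrow> (\<exists>V\<in>?B. x \<in> V \<and> V \<subseteq> U)"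
  proof (intro allI impI)
    fix U assume "openin T U \<and> x \<in> U"
    then obtain n where "{y \<in> X. D x y < ereal (inverse (real (Suc n)))} \<subseteq> U"
      using openin_T_includes_disk by blast
    moreover have "x \<in> {y \<in> X. D x y < ereal (inverse (real (Suc n)))}"
      using x by (simp add: D_self)
    ultimately show "\<exists>V\<in>?B. x \<in> V \<and> V \<subseteq> U" by blast
  qed
  ultimately show "\<exists>\<B>. countable \<B> \<and> (\<forall>V\<in>\<B>. openin T V) \<and>
      (\<forall>U. openin T U \<and> x \<in> U \<longrightarrow> (\<exists>V\<in>\<B>. x \<in> V \<and> V \<subseteq> U))" by blast
qed

lemma conv_of_topology_T: "conv_of_topology T = C"
proof (intro set_eqI iffI)
  fix p assume "p \<in> conv_of_topology T"
  then obtain xs x where p: "p = (xs, x)" and xs: "\<And>i. xs i \<in> X" and lim: "limitin T xs x sequentially"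
    by (auto simp: conv_of_topology_def)
  have x: "x \<in> X" using lim by (simp add: limitin_def)
  have "\<forall>\<^sub>F i in sequentially. D x (xs i) < e" if "e > 0" for e
    using lim openin_T_disk[OF x, of e] x that by (auto simp: limitin_def D_self elim: eventually_mono)
  then have "(\<lambda>i. D x (xs i)) \<longlonglongrightarrow> 0"
    using xs x D_nonneg by (subst tendsto_0_ereal_iff) auto
  then show "p \<in> C" using p xs x by (simp add: C_iff)
next
  fix p assume p: "p \<in> C"
  then show "p \<in> conv_of_topology T"
    by (cases p)
      (auto simp: conv_of_topology_def limitin_def C_iff openin_topology_of_conv conv_openset_def)
qed

text \<open>For a general convergence the right side may be strictly finer. Here a set open for the
  restricted convergence is the trace of a union of disks of \<open>X\<close>, which are
  \<open>T\<close>-open.\<close>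

lemma subtopology_T:
  assumes Y: "Y \<subseteq> X" shows "subtopology T Y = topology_of_conv Y (conv_restrict C Y)"
proof (rule topology_eq[THEN iffD2], intro allI iffI)
  fix U assume "openin (subtopology T Y) U"
  then obtain W where "conv_openset X C W" "U = W \<inter> Y"
    by (auto simp: openin_subtopology openin_topology_of_conv)
  then show "openin (topology_of_conv Y (conv_restrict C Y)) U"
    unfolding openin_topology_of_conv conv_openset_def conv_restrict_def
    by (auto simp: Pi_iff)
next
  fix U assume "openin (topology_of_conv Y (conv_restrict C Y)) U"
  then have U: "conv_openset Y (conv_restrict C Y) U" by (simp add: openin_topology_of_conv)
  then have UY: "U \<subseteq> Y" by (simp add: conv_openset_def)
  define \<W> where "\<W> = {{y \<in> X. D x y < e} |x e. x \<in> U \<and> {y \<in> X. D x y < e} \<inter> Y \<subseteq> U}"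
  have "openin T (\<Union>\<W>)"
    using openin_T_disk UY Y by (intro openin_Union) (auto simp: \<W>_def)
  moreover have "U = \<Union>\<W> \<inter> Y"
  proof
    show "U \<subseteq> \<Union>\<W> \<inter> Y"
    proof
      fix x assume x: "x \<in> U"
      obtain n where n: "{y \<in> Y. D x y < ereal (inverse (real (Suc n)))} \<subseteq> U"
        using conv_openset_includes_disk[OF Y U x] by blast
      let ?V = "{y \<in> X. D x y < ereal (inverse (real (Suc n)))}"
      have "?V \<in> \<W>" unfolding \<W>_def using n x by blast
      moreover have "x \<in> ?V" using x UY Y by (auto simp: D_self)
      ultimately show "x \<in> \<Union>\<W> \<inter> Y" using x UY by blast
    qed
  qed (auto simp: \<W>_def)
  ultimately show "openin (subtopology T Y) U" by (auto simp: openin_subtopology)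
qed

lemma closure_of_T:
  assumes "Y \<subseteq> X" shows "T closure_of Y = {x \<in> X. (INF y\<in>Y. D x y) = 0}"
proof (intro set_eqI iffI)
  fix x assume x: "x \<in> T closure_of Y"
  then have xX: "x \<in> X" by (simp add: in_closure_of)
  have "\<exists>y\<in>Y. D x y < e" if "e > 0" for e
  proof -
    have "x \<in> {y \<in> X. D x y < e}" using xX that by (simp add: D_self)
    moreover have "\<forall>U. x \<in> U \<and> openin T U \<longrightarrow> (\<exists>y. y \<in> Y \<and> y \<in> U)"
      using x by (simp add: in_closure_of)
    ultimately obtain y where "y \<in> Y" "y \<in> {y \<in> X. D x y < e}"
      using openin_T_disk[OF xX, of e] by meson
    then show ?thesis by blast
  qed
  then show "x \<in> {x \<in> X. (INF y\<in>Y. D x y) = 0}"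
    using xX assms D_nonneg by (subst mem_Collect_eq, subst INF_eq_0_iff) auto
next
  fix x assume "x \<in> {x \<in> X. (INF y\<in>Y. D x y) = 0}"
  then have x: "x \<in> X" and near: "\<And>e. e > 0 \<Longrightarrow> \<exists>y\<in>Y. D x y < e"
    using INF_eq_0_iff[of Y "D x"] assms D_nonneg by auto
  have "\<exists>y. y \<in> Y \<and> y \<in> U" if xU: "x \<in> U" "openin T U" for U
  proof -
    obtain n where n: "{y \<in> X. D x y < ereal (inverse (real (Suc n)))} \<subseteq> U"
      using openin_T_includes_disk[OF xU(2,1)] by blast
    obtain y where "y \<in> Y" "D x y < ereal (inverse (real (Suc n)))"
      using near[of "ereal (inverse (real (Suc n)))"] by auto
    then show ?thesis using n assms by blast
  qed
  then show "x \<in> T closure_of Y" using x by (auto simp: in_closure_of)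
qed

lemma INF_eq_0_iff_sequence:
  assumes "Y \<subseteq> X" "x \<in> X"
  shows "(INF y\<in>Y. D x y) = 0 \<longleftrightarrow> (\<exists>ys\<in>UNIV \<rightarrow> Y. (\<lambda>i. D x (ys i)) \<longlonglongrightarrow> 0)" (is ?tendsto)
    and "(INF y\<in>Y. D x y) = 0 \<longleftrightarrow> (\<exists>ys\<in>UNIV \<rightarrow> Y. (INF i::nat. D x (ys i)) = 0)" (is ?INF)
proof -
  have nonneg: "0 \<le> D x y" if "y \<in> Y" for y using that assms D_nonneg by blast
  have 1: "\<exists>ys\<in>UNIV \<rightarrow> Y. (\<lambda>i. D x (ys i)) \<longlonglongrightarrow> 0" if "(INF y\<in>Y. D x y) = 0"
  proof -
    have "\<forall>n. \<exists>y\<in>Y. D x y < ereal (inverse (real (Suc n)))"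
      using that INF_eq_0_iff[of Y "D x"] nonneg by simp
    then obtain ys where "\<And>n. ys n \<in> Y \<and> D x (ys n) < ereal (inverse (real (Suc n)))"
      by metis
    then show ?thesis
      using nonneg by (intro bexI[of _ ys] tendsto_0_if_less_inverse) auto
  qed
  have 2: "(INF i::nat. D x (ys i)) = 0" if "ys \<in> UNIV \<rightarrow> Y" "(\<lambda>i. D x (ys i)) \<longlonglongrightarrow> 0" for ys
  proof -
    have "\<exists>i. D x (ys i) < e" if "e > 0" for e
      using order_tendstoD(2)[OF \<open>(\<lambda>i. D x (ys i)) \<longlonglongrightarrow> 0\<close> that] by (auto simp: eventually_sequentially)
    then show ?thesis
      using that(1) nonneg by (subst INF_eq_0_iff) auto
  qed
  have 3: "(INF y\<in>Y. D x y) = 0" if "ys \<in> UNIV \<rightarrow> Y" "(INF i::nat. D x (ys i)) = 0" for ys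
  proof -
    have "\<forall>e>0. \<exists>i. D x (ys i) < e"
      using that nonneg by (subst (asm) INF_eq_0_iff) auto
    then show ?thesis
      using that(1) nonneg by (subst INF_eq_0_iff) (auto, blast)
  qed
  show ?tendsto ?INF using 1 2 3 by blast+
qed

end

subsection \<open>Faces of the state space\<close>

lemma face_refines:
  fixes S :: "'a::real_normed_vector set"
  assumes "F face_of S" "G face_of S" "x \<in> rel_interior F" "x \<in> rel_interior G"
  shows "F = G"
  using face_of_eq[OF assms(1,2)] assms(3,4) by blast

context
  fixes A :: "(complex^'n^'n) set"
  assumes sub: "subspace A"
begin

text \<open>The coefficients may be negative: besides convexity this serves to prolong a segment
  past its end, where positivity has to be checked on the form.\<close>

lemma affine_state:
  assumes a: "a \<in> state_space A" and b: "b \<in> state_space A" and uv: "u + v = 1"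
    and nonneg: "\<And>w. 0 \<le> u * (w \<bullet> (a *v w)) + v * (w \<bullet> (b *v w))"
  shows "u *\<^sub>R a + v *\<^sub>R b \<in> state_space A"
proof -
  have "u *\<^sub>R a + v *\<^sub>R b \<in> A"
    using a b sub by (auto simp: state_space_def intro!: subspace_add subspace_scale)
  moreover have "psd (u *\<^sub>R a + v *\<^sub>R b)"
    using nonneg state_hermitian[OF a] state_hermitian[OF b]
    by (simp add: psd_def mat_adjoint_linear mv.add_left mv.scaleR_left inner_add_right)
  moreover have "trace (u *\<^sub>R a + v *\<^sub>R b) = 1"
  proof -
    have "trace (u *\<^sub>R a + v *\<^sub>R b) = u *\<^sub>R trace a + v *\<^sub>R trace b"
      by (simp add: trace_def sum.distrib scaleR_sum_right)
    then show ?thesis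
      using a b uv by (simp add: state_space_def flip: scaleR_add_left)
  qed
  ultimately show ?thesis by (simp add: state_space_def)
qed

lemma convex_state_space: "convex (state_space A)"
  unfolding convex_def
  by (intro ballI allI impI affine_state add_nonneg_nonneg mult_nonneg_nonneg psd_nonneg state_psd)

text \<open>Nonnegative forms with positive coefficients add up to 0 only if both vanish.\<close>

lemma mker_convex_combination:
  assumes a: "a \<in> state_space A" and b: "b \<in> state_space A" and u: "0 < u" "u < 1"
  shows "mker ((1 - u) *\<^sub>R a + u *\<^sub>R b) = mker a \<inter> mker b"
proof
  show "mker ((1 - u) *\<^sub>R a + u *\<^sub>R b) \<subseteq> mker a \<inter> mker b"
  proof
    fix v assume "v \<in> mker ((1 - u) *\<^sub>R a + u *\<^sub>R b)"
    then have "(1 - u) * (v \<bullet> (a *v v)) + u * (v \<bullet> (b *v v)) = v \<bullet> 0"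
      by (simp add: mker_def mv.add_left mv.scaleR_left flip: inner_add_right inner_scaleR_right)
    moreover have "0 \<le> v \<bullet> (a *v v)" "0 \<le> v \<bullet> (b *v v)"
      using a b by (simp_all add: psd_nonneg state_psd)
    ultimately have "v \<bullet> (a *v v) = 0" "v \<bullet> (b *v v) = 0"
      using u by (simp_all add: add_nonneg_eq_0_iff)
    then show "v \<in> mker a \<inter> mker b"
      using psd_form_zero state_psd[OF a] state_psd[OF b] by blast
  qed
qed (auto simp: mker_def mv.add_left mv.scaleR_left)

text \<open>For a state \<open>\<rho>\<close> this is the smallest face containing it, since
  \<open>\<rho>\<close> lies in its relative interior.\<close>

definition kernel_face :: "complex^'n^'n \<Rightarrow> (complex^'n^'n) set" where
  "kernel_face \<rho> = {\<sigma> \<in> state_space A. mker \<rho> \<subseteq> mker \<sigma>}"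

lemma kernel_face_face: "kernel_face \<rho> face_of state_space A"
  unfolding face_of_def
proof (intro conjI ballI impI)
  show "convex (kernel_face \<rho>)"
    unfolding convex_def kernel_face_def
    using convex_state_space[unfolded convex_def]
    by (auto simp: mker_def subset_iff mv.add_left mv.scaleR_left)
  fix a b x
  assume *: "a \<in> state_space A" "b \<in> state_space A" "x \<in> kernel_face \<rho>" "x \<in> open_segment a b"
  then obtain u where "0 < u" "u < 1" "x = (1 - u) *\<^sub>R a + u *\<^sub>R b"
    by (auto simp: in_segment)
  then show "a \<in> kernel_face \<rho>" "b \<in> kernel_face \<rho>"
    using * mker_convex_combination[of a b u] by (auto simp: kernel_face_def)
qed (auto simp: kernel_face_def)

text \<open>If the kernel of \<open>\<rho>\<close> is contained in that of \<open>\<sigma>\<close>, then \<open>\<sigma> \<le> K \<rho>\<close> for some \<open>K\<close>, so the segment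
  from \<open>\<sigma>\<close> to \<open>\<rho>\<close> can be prolonged beyond \<open>\<rho>\<close>.\<close>

lemma rel_interior_kernel_face:
  assumes \<rho>: "\<rho> \<in> state_space A" shows "\<rho> \<in> rel_interior (kernel_face \<rho>)"
proof -
  have "\<rho> \<in> kernel_face \<rho>" using \<rho> by (simp add: kernel_face_def)
  moreover have "\<exists>e>1. (1 - e) *\<^sub>R \<sigma> + e *\<^sub>R \<rho> \<in> kernel_face \<rho>" if "\<sigma> \<in> kernel_face \<rho>" for \<sigma>
  proof -
    have \<sigma>: "\<sigma> \<in> state_space A" "mker \<rho> \<subseteq> mker \<sigma>" using that by (auto simp: kernel_face_def)
    obtain k where k: "k > 0" "\<And>b v. mat_adjoint b = b \<Longrightarrow> mker \<rho> \<subseteq> mker b \<Longrightarrow>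
        \<bar>v \<bullet> (b *v v)\<bar> \<le> k * norm b * (v \<bullet> (\<rho> *v v))"
      using form_bounded_by_psd[OF state_psd[OF \<rho>]] by blast
    define K where "K = k * norm \<sigma>"
    have K: "K \<ge> 0" using k(1) by (simp add: K_def)
    \<comment> \<open>Gives \<open>t * K \<le> 1\<close>, so \<open>\<rho>\<close> dominates t times
      \<open>\<sigma>\<close>, and subtracting the latter from (1 + t) times \<open>\<rho>\<close>
      keeps the form nonnegative.\<close>
    define t where "t = 1 / (K + 1)"
    have t: "t > 0" "t * K \<le> 1" using K by (auto simp: t_def)
    have "(1 - (1 + t)) *\<^sub>R \<sigma> + (1 + t) *\<^sub>R \<rho> \<in> state_space A"
    proof (rule affine_state[OF \<sigma>(1) \<rho>])
      fix w
      let ?q = "w \<bullet> (\<rho> *v w)"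
      have q: "?q \<ge> 0" by (rule psd_nonneg[OF state_psd[OF \<rho>]])
      have "w \<bullet> (\<sigma> *v w) \<le> K * ?q"
        using k(2)[OF state_hermitian[OF \<sigma>(1)] \<sigma>(2), of w] unfolding K_def by linarith
      then have "t * (w \<bullet> (\<sigma> *v w)) \<le> t * (K * ?q)" using t(1) by simp
      also have "\<dots> \<le> 1 * ?q" unfolding mult.assoc[symmetric] by (rule mult_right_mono[OF t(2) q])
      also have "\<dots> \<le> (1 + t) * ?q" using t(1) q by (intro mult_right_mono) auto
      finally show "0 \<le> (1 - (1 + t)) * (w \<bullet> (\<sigma> *v w)) + (1 + t) * ?q" by simp
    qed simp
    moreover have "mker \<rho> \<subseteq> mker ((1 - (1 + t)) *\<^sub>R \<sigma> + (1 + t) *\<^sub>R \<rho>)"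
      using \<sigma>(2) by (auto simp: mker_def mv.add_left mv.diff_left mv.scaleR_left)
    ultimately show ?thesis
      using t(1) by (intro exI[of _ "1 + t"]) (simp add: kernel_face_def)
  qed
  ultimately show ?thesis
    using convex_rel_interior_iff[of "kernel_face \<rho>" \<rho>] face_of_imp_convex[OF kernel_face_face]
    by blast
qed

text \<open>A face is determined by any point of its relative interior, so \<open>F\<close> is the
  kernel face of each such point; two points in each other's kernel face have equal kernels.\<close>

lemma rel_interior_face:
  assumes F: "F face_of state_space A" and \<rho>: "\<rho> \<in> rel_interior F"
  shows "rel_interior F = {\<sigma> \<in> state_space A. mker \<sigma> = mker \<rho>}"
proof -
  have F_eq: "F = kernel_face \<tau>" if "\<tau> \<in> rel_interior F" for \<tau>
  proof -
    have "\<tau> \<in> state_space A" using that rel_interior_subset face_of_imp_subset[OF F] by blast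
    then show ?thesis by (intro face_refines[OF F kernel_face_face that] rel_interior_kernel_face)
  qed
  show ?thesis
  proof (intro set_eqI iffI)
    fix \<sigma> assume \<sigma>: "\<sigma> \<in> rel_interior F"
    then have "\<sigma> \<in> kernel_face \<rho>" "\<rho> \<in> kernel_face \<sigma>"
      using F_eq \<rho> rel_interior_subset by blast+
    then show "\<sigma> \<in> {\<sigma> \<in> state_space A. mker \<sigma> = mker \<rho>}" by (auto simp: kernel_face_def)
  next
    fix \<sigma> assume "\<sigma> \<in> {\<sigma> \<in> state_space A. mker \<sigma> = mker \<rho>}"
    then have \<sigma>: "\<sigma> \<in> state_space A" "mker \<sigma> = mker \<rho>" by auto
    then have "kernel_face \<sigma> = F" using F_eq[OF \<rho>] by (simp add: kernel_face_def)
    then show "\<sigma> \<in> rel_interior F" using rel_interior_kernel_face[OF \<sigma>(1)] by simp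
  qed
qed

lemma UN_rel_interior_faces:
  "(\<Union>F \<in> {F. F face_of state_space A \<and> F \<noteq> {}}. rel_interior F) = state_space A"
proof
  show "(\<Union>F \<in> {F. F face_of state_space A \<and> F \<noteq> {}}. rel_interior F) \<subseteq> state_space A"
    using rel_interior_subset face_of_imp_subset by blast
  show "state_space A \<subseteq> (\<Union>F \<in> {F. F face_of state_space A \<and> F \<noteq> {}}. rel_interior F)"
    using rel_interior_kernel_face kernel_face_face rel_interior_subset by blast
qed

lemma disjoint_rel_interior_faces:
  "disjoint_family_on rel_interior {F. F face_of state_space A \<and> F \<noteq> {}}"
  unfolding disjoint_family_on_def using face_refines by blast

end

subsection \<open>The two information topologies\<close>

lemma subspace_cstar_subalgebra:
  fixes A :: "(complex^'n^'n) set"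
  assumes "cstar_subalgebra A" shows "subspace A"
proof -
  have scale: "(\<chi> i j. c * a $ i $ j) \<in> A" if "a \<in> A" for c a
    using assms that by (simp add: cstar_subalgebra_def)
  obtain a where a: "a \<in> A" using assms by (auto simp: cstar_subalgebra_def)
  have "(\<chi> i j. 0 * a $ i $ j) = (0 :: complex^'n^'n)" by (simp add: vec_eq_iff)
  moreover have "(\<chi> i j. of_real r * b $ i $ j) = r *\<^sub>R b" for r and b :: "complex^'n^'n"
    by (simp add: vec_eq_iff flip: scaleR_conv_of_real)
  ultimately show ?thesis
    using scale[OF a, of 0] scale[of _ "of_real _"] assms
    by (auto simp: subspace_def cstar_subalgebra_def)
qed

lemma info_conv_eq: "info_conv A \<omega> = div_conv (state_space A) (info_div \<omega>)"
  by (simp add: info_conv_def div_conv_def)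

lemma divergence_info_div: "divergence (state_space A) (info_div \<omega>)"
proof
  fix x y assume x: "x \<in> state_space A" and y: "y \<in> state_space A"
  have norm: "ereal ((norm (x - y))\<^sup>2 / 2) \<le> info_div \<omega> x y"
    using rel_entropy_ge_norm[OF x y] rel_entropy_ge_norm[OF y x]
    by (cases \<omega>) (simp_all add: norm_minus_commute)
  show "0 \<le> info_div \<omega> x y"
    by (rule order_trans[OF _ norm]) simp
  show "x = y" if "info_div \<omega> x y = 0"
    using norm that by (simp add: zero_ereal_def)
next
  fix x assume "x \<in> state_space A"
  then show "info_div \<omega> x x = 0" by (cases \<omega>) (simp_all add: rel_entropy_self)
next
  fix xs x y
  assume *: "\<And>i. xs i \<in> state_space A" "x \<in> state_space A" "y \<in> state_space A"
    "(\<lambda>i. info_div \<omega> x (xs i)) \<longlonglongrightarrow> 0"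
  then show "(\<lambda>i. info_div \<omega> y (xs i)) \<longlonglongrightarrow> info_div \<omega> y x"
    by (cases \<omega>)
      (auto intro: rel_entropy_left_continuous[of xs A x y] rel_entropy_right_continuous[of xs A x y])
qed

lemma info_conv_subset_norm_conv: "info_conv A \<omega> \<subseteq> norm_conv A"
proof (clarsimp simp: info_conv_def norm_conv_def Pi_iff)
  fix xs x
  assume *: "\<forall>i. xs i \<in> state_space A" "x \<in> state_space A" "(\<lambda>i. info_div \<omega> x (xs i)) \<longlonglongrightarrow> 0"
  then show "xs \<longlonglongrightarrow> x"
    using tendsto_norm_if_rel_entropy[of xs A x] by (cases \<omega>) auto
qed

lemma info_conv_I_subset_rI: "info_conv A kind_I \<subseteq> info_conv A kind_rI"
  by (auto simp: info_conv_def Pi_iff intro!: rel_entropy_left_imp_right)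

lemma topology_le_of_conv:
  "C \<subseteq> C' \<Longrightarrow> topology_le (topology_of_conv X C') (topology_of_conv X C)"
  by (auto simp: topology_le_def openin_topology_of_conv conv_openset_def)

text \<open>Metric spaces are sequential: a point of \<open>U\<close> in the closure of the
  complement would be a limit of a sequence avoiding \<open>U\<close>. Norm topologies can then be
  compared through their convergences.\<close>

lemma topology_of_metric_conv:
  fixes Y :: "'a::metric_space set"
  shows "topology_of_conv Y {(xs, x). xs \<in> UNIV \<rightarrow> Y \<and> x \<in> Y \<and> xs \<longlonglongrightarrow> x} = top_of_set Y"
    (is "topology_of_conv Y ?C = _")
proof (rule topology_eq[THEN iffD2], intro allI iffI)
  fix U assume "openin (top_of_set Y) U"
  then obtain V where "open V" "U = Y \<inter> V" by (auto simp: openin_open)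
  then show "openin (topology_of_conv Y ?C) U"
    by (auto simp: openin_topology_of_conv conv_openset_def Pi_iff dest: topological_tendstoD)
next
  fix U assume "openin (topology_of_conv Y ?C) U"
  then have U: "conv_openset Y ?C U" by (simp add: openin_topology_of_conv)
  then have "U \<subseteq> Y" by (simp add: conv_openset_def)
  have "x \<notin> closure (Y - U)" if "x \<in> U" for x
  proof
    assume "x \<in> closure (Y - U)"
    then obtain xs where xs: "\<And>n. xs n \<in> Y - U" "xs \<longlonglongrightarrow> x"
      by (auto simp: closure_sequential)
    then have "(xs, x) \<in> ?C" using that \<open>U \<subseteq> Y\<close> by auto
    then have "\<forall>\<^sub>F i in sequentially. xs i \<in> U"
      using U that unfolding conv_openset_def by blast
    then show False using xs by (auto simp: eventually_sequentially)
  qed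
  then have "U = Y \<inter> - closure (Y - U)"
    using \<open>U \<subseteq> Y\<close> closure_subset[of "Y - U"] by blast
  then show "openin (top_of_set Y) U" by (metis openin_open open_Compl closed_closure)
qed

lemma norm_topology_eq: "norm_topology A = topology_of_conv (state_space A) (norm_conv A)"
  unfolding norm_topology_def norm_conv_def by (rule topology_of_metric_conv[symmetric])

lemma Hausdorff_space_finer:
  assumes "Hausdorff_space T" "topology_le T T'" "topspace T' = topspace T"
  shows "Hausdorff_space T'"
  using assms unfolding Hausdorff_space_def topology_le_def by (metis mem_Collect_eq subsetD)

text \<open>All kernels agree on a relative interior, so the kernel conditions of
  \<open>tendsto_rel_entropy_left\<close> hold and norm convergence suffices.\<close>

lemma conv_restrict_rel_interior_face:
  assumes "subspace A" "F face_of state_space A"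
  shows "conv_restrict (info_conv A kind_I) (rel_interior F) =
    conv_restrict (norm_conv A) (rel_interior F)"
proof
  show "conv_restrict (info_conv A kind_I) (rel_interior F)
      \<subseteq> conv_restrict (norm_conv A) (rel_interior F)"
    using info_conv_subset_norm_conv[of A kind_I] by (auto simp: conv_restrict_def)
  show "conv_restrict (norm_conv A) (rel_interior F)
      \<subseteq> conv_restrict (info_conv A kind_I) (rel_interior F)"
  proof (clarsimp simp: conv_restrict_def norm_conv_def info_conv_def Pi_iff)
    fix xs x
    assume *: "\<forall>i. xs i \<in> state_space A" "x \<in> state_space A" "xs \<longlonglongrightarrow> x"
      "\<forall>i. xs i \<in> rel_interior F" "x \<in> rel_interior F"
    have "mker x = mker (xs i)" for i
      using rel_interior_face[OF assms *(5)] *(4) by blast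
    then have "(\<lambda>i. rel_entropy (xs i) x) \<longlonglongrightarrow> rel_entropy x x"
      using * by (intro tendsto_rel_entropy_left[of xs A x]) auto
    then show "(\<lambda>i. rel_entropy (xs i) x) \<longlonglongrightarrow> 0" using *(2) by (simp add: rel_entropy_self)
  qed
qed

lemma subtopology_rel_interior_face:
  assumes "subspace A" "F face_of state_space A"
  shows "subtopology (info_topology A kind_I) (rel_interior F) =
    subtopology (norm_topology A) (rel_interior F)"
proof -
  interpret divergence "state_space A" "info_div kind_I" by (rule divergence_info_div)
  have sub: "rel_interior F \<subseteq> state_space A"
    using face_of_imp_subset[OF assms(2)] rel_interior_subset by blast
  have "subtopology (info_topology A kind_I) (rel_interior F)
      = topology_of_conv (rel_interior F) (conv_restrict (norm_conv A) (rel_interior F))"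
    using subtopology_T[OF sub] conv_restrict_rel_interior_face[OF assms]
    by (simp add: info_topology_def info_conv_eq)
  also have "conv_restrict (norm_conv A) (rel_interior F) =
      {(xs, x). xs \<in> UNIV \<rightarrow> rel_interior F \<and> x \<in> rel_interior F \<and> xs \<longlonglongrightarrow> x}"
    using sub by (auto simp: conv_restrict_def norm_conv_def)
  also have "topology_of_conv (rel_interior F) \<dots> = top_of_set (rel_interior F)"
    by (rule topology_of_metric_conv)
  also have "\<dots> = subtopology (norm_topology A) (rel_interior F)"
    using sub by (simp add: norm_topology_def subtopology_subtopology inf_absorb2)
  finally show ?thesis .
qed

text \<open>Connectedness depends only on the subspace topology, which here is that of the norm,
  where convexity applies.\<close>

lemma connectedin_rel_interior_face:
  assumes "subspace A" "F face_of state_space A"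
  shows "connectedin (info_topology A kind_I) (rel_interior F)"
proof -
  have "connected (rel_interior F)"
    using face_of_imp_convex[OF assms(2)] by (intro convex_connected convex_rel_interior)
  moreover have "rel_interior F \<subseteq> state_space A"
    using face_of_imp_subset[OF assms(2)] rel_interior_subset by blast
  ultimately have "connectedin (norm_topology A) (rel_interior F)"
    by (simp add: norm_topology_def connectedin_subtopology)
  then show ?thesis
    using subtopology_rel_interior_face[OF assms] by (metis connectedin_absolute)
qed

text \<open>Kernels are eventually constant along convergent sequences, so any condition on the
  kernel alone defines an open set. A relative interior is thereby clopen, and a connected set
  meeting it stays inside.\<close>

lemma rel_interior_face_component:
  assumes A: "subspace A" and F: "F face_of state_space A" "F \<noteq> {}"
  shows "rel_interior F \<in> connected_components_of (info_topology A kind_I)"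
proof -
  let ?T = "info_topology A kind_I"
  interpret divergence "state_space A" "info_div kind_I" by (rule divergence_info_div)
  have T: "?T = T" by (simp add: info_topology_def info_conv_eq)
  obtain \<rho> where \<rho>: "\<rho> \<in> rel_interior F"
    using F rel_interior_eq_empty face_of_imp_convex by blast
  have ri: "rel_interior F = {\<sigma> \<in> state_space A. mker \<sigma> = mker \<rho>}"
    by (rule rel_interior_face[OF A F(1) \<rho>])
  have opens: "openin ?T {\<sigma> \<in> state_space A. P (mker \<sigma>)}" for P
    unfolding T openin_topology_of_conv conv_openset_def
  proof (intro conjI allI impI)
    fix xs x assume *: "x \<in> {\<sigma> \<in> state_space A. P (mker \<sigma>)}" "(xs, x) \<in> C"
    then have "\<forall>\<^sub>F i in sequentially. mker (xs i) = mker x"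
      by (intro eventually_mker_eq[of xs A]) (auto simp: C_iff)
    then show "\<forall>\<^sub>F i in sequentially. xs i \<in> {\<sigma> \<in> state_space A. P (mker \<sigma>)}"
      using * by (auto simp: C_iff elim: eventually_mono)
  qed auto
  have "topspace ?T - rel_interior F = {\<sigma> \<in> state_space A. mker \<sigma> \<noteq> mker \<rho>}"
    by (auto simp: T ri)
  then have closed: "closedin ?T (rel_interior F)"
    using opens[of "\<lambda>K. K \<noteq> mker \<rho>"] by (auto simp: closedin_def T ri)
  have "connected_component_of_set ?T \<rho> = rel_interior F"
  proof
    have "\<rho> \<in> topspace ?T" using \<rho> ri by (auto simp: T)
    then have "\<rho> \<in> connected_component_of_set ?T \<rho>" by (simp add: connected_component_of_refl)
    moreover have "connectedin ?T (connected_component_of_set ?T \<rho>)"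
      by (rule connectedin_connected_component_of)
    ultimately show "connected_component_of_set ?T \<rho> \<subseteq> rel_interior F"
      using connectedin_clopen_cases[OF _ closed] opens[of "\<lambda>K. K = mker \<rho>"] \<rho>
      unfolding ri disjnt_iff by blast
    show "rel_interior F \<subseteq> connected_component_of_set ?T \<rho>"
      using connectedin_rel_interior_face[OF A F(1)] \<rho> by (rule connected_component_of_maximal)
  qed
  then show ?thesis
    unfolding connected_components_of_def using \<rho> ri by (force simp: T)
qed

text \<open>A state is approached along the segment from a relatively interior state; the points on
  its nearer half dominate half of the state, which yields rI-convergence.\<close>

lemma closure_of_rel_interior_state_space:
  assumes A: "subspace A"
  shows "info_topology A kind_rI closure_of rel_interior (state_space A) = state_space A"
proof -
  interpret divergence "state_space A" "info_div kind_rI" by (rule divergence_info_div)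
  have T: "info_topology A kind_rI = T" by (simp add: info_topology_def info_conv_eq)
  note conv = convex_state_space[OF A]
  have "(INF \<tau>\<in>rel_interior (state_space A). info_div kind_rI \<rho> \<tau>) = 0"
    if \<rho>: "\<rho> \<in> state_space A" for \<rho>
  proof -
    obtain \<tau> where \<tau>: "\<tau> \<in> rel_interior (state_space A)"
      using \<rho> conv rel_interior_eq_empty by blast
    then have \<tau>': "\<tau> \<in> state_space A" using rel_interior_subset by blast
    \<comment> \<open>The double \<open>Suc\<close> starts the sequence at 1/2, which gives the
      domination constant 2.\<close>
    define t where "t i = inverse (real (Suc (Suc i)))" for i
    have t: "0 < t i" "t i \<le> 1 / 2" for i by (auto simp: t_def field_simps)
    define x where "x i = \<rho> - t i *\<^sub>R (\<rho> - \<tau>)" for i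
    have x_ri: "x i \<in> rel_interior (state_space A)" for i
      unfolding x_def using t(2)[of i]
      by (intro rel_interior_convex_shrink[OF conv \<tau> \<rho> t(1)]) simp
    then have x: "x i \<in> state_space A" for i using rel_interior_subset by blast
    have "t \<longlonglongrightarrow> 0"
      unfolding t_def by (rule LIMSEQ_Suc[OF LIMSEQ_inverse_real_of_nat])
    then have "(\<lambda>i. \<rho> - t i *\<^sub>R (\<rho> - \<tau>)) \<longlonglongrightarrow> \<rho> - 0 *\<^sub>R (\<rho> - \<tau>)"
      by (intro tendsto_intros)
    then have "x \<longlonglongrightarrow> \<rho>" by (simp add: x_def[abs_def])
    moreover have "v \<bullet> (\<rho> *v v) \<le> 2 * (v \<bullet> (x i *v v))" for i v
    proof -
      have nonneg: "0 \<le> v \<bullet> (\<rho> *v v)" "0 \<le> v \<bullet> (\<tau> *v v)"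
        using psd_nonneg state_psd \<rho> \<tau>' by blast+
      have "v \<bullet> (x i *v v) = v \<bullet> (\<rho> *v v) - t i * (v \<bullet> (\<rho> *v v)) + t i * (v \<bullet> (\<tau> *v v))"
        by (simp add: x_def mv.diff_left mv.scaleR_left inner_diff_right right_diff_distrib)
      moreover have "t i * (v \<bullet> (\<rho> *v v)) \<le> 1 / 2 * (v \<bullet> (\<rho> *v v))"
        by (rule mult_right_mono[OF t(2) nonneg(1)])
      moreover have "0 \<le> t i * (v \<bullet> (\<tau> *v v))"
        using t(1)[of i] nonneg(2) by simp
      ultimately show ?thesis by linarith
    qed
    ultimately have "(\<lambda>i. rel_entropy \<rho> (x i)) \<longlonglongrightarrow> 0"
      by (intro tendsto_rel_entropy_right_if_dominated[OF x \<rho>, where c = 2]) auto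
    then show ?thesis
      using x_ri INF_eq_0_iff_sequence(1)[OF rel_interior_subset \<rho>] by auto
  qed
  then show ?thesis
    unfolding T by (subst closure_of_T[OF rel_interior_subset]) auto
qed

text \<open>The relative interior of the whole state space is connected in the finer I-topology,
  hence in the rI-topology, where it is dense.\<close>

lemma connected_space_rI:
  assumes A: "subspace A" shows "connected_space (info_topology A kind_rI)"
proof -
  interpret I: divergence "state_space A" "info_div kind_I" by (rule divergence_info_div)
  interpret rI: divergence "state_space A" "info_div kind_rI" by (rule divergence_info_div)
  have T: "info_topology A kind_I = I.T" "info_topology A kind_rI = rI.T"
    by (simp_all add: info_topology_def info_conv_eq)
  have le: "topology_le rI.T I.T"
    using info_conv_I_subset_rI by (intro topology_le_of_conv) (simp add: info_conv_eq)
  have "continuous_map I.T rI.T id"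
    unfolding continuous_map_def
  proof (intro conjI allI impI)
    fix U assume U: "openin rI.T U"
    then have "{x \<in> topspace I.T. id x \<in> U} = U"
      using openin_subset[OF U] by auto
    then show "openin I.T {x \<in> topspace I.T. id x \<in> U}"
      using U le by (auto simp: topology_le_def)
  qed simp
  moreover have "connectedin I.T (rel_interior (state_space A))"
    using connectedin_rel_interior_face[OF A face_of_refl[OF convex_state_space[OF A]]]
    by (simp add: T)
  ultimately have "connectedin rI.T (id ` rel_interior (state_space A))"
    by (rule connectedin_continuous_map_image)
  then have "connectedin rI.T (rI.T closure_of rel_interior (state_space A))"
    by (intro connectedin_closure_of) simp
  then have "connectedin rI.T (topspace rI.T)"
    using closure_of_rel_interior_state_space[OF A] by (simp add: T)
  then show ?thesis unfolding T using connectedin_topspace by blast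
qed

theorem theorem5p18:
  fixes A :: "(complex^'n^'n) set" and \<omega> :: info_kind
  assumes "cstar_subalgebra A"
  shows
    "(Lstar_conv (state_space A) (info_conv A \<omega>) \<and>
      conv_of_topology (info_topology A \<omega>) = info_conv A \<omega> \<and>
      (\<forall>X. X \<subseteq> state_space A \<longrightarrow>
         seq_closure (state_space A) (info_conv A \<omega>) X = info_closure A \<omega> X \<and>
         info_closure A \<omega> X =
           {\<rho> \<in> state_space A. \<exists>\<rho>s \<in> UNIV \<rightarrow> X. (\<lambda>i::nat. info_div \<omega> \<rho> (\<rho>s i)) \<longlonglongrightarrow> 0} \<and>
         info_closure A \<omega> X =
           {\<rho> \<in> state_space A. \<exists>\<rho>s \<in> UNIV \<rightarrow> X. (INF i::nat. info_div \<omega> \<rho> (\<rho>s i)) = 0})) \<and>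
     (unique_limits (info_conv A \<omega>) \<and>
      info_conv A \<omega> \<subseteq> norm_conv A \<and>
      topology_le (norm_topology A) (info_topology A \<omega>) \<and>
      Hausdorff_space (info_topology A \<omega>)) \<and>
     ((\<forall>\<rho> \<in> state_space A.
         conv_continuous (state_space A) (info_conv A \<omega>)
           {0..\<infinity>} (conv_of_topology ext_topology) (info_div \<omega> \<rho>) \<and>
         continuous_map (info_topology A \<omega>) ext_topology (info_div \<omega> \<rho>) \<and>
         (\<forall>\<epsilon>>0. openin (info_topology A \<omega>) (open_disk A \<omega> \<rho> \<epsilon>) \<and>
                closedin (info_topology A \<omega>) (closed_disk A \<omega> \<rho> \<epsilon>)) \<and>
         base_at (info_topology A \<omega>) \<rho> {open_disk A \<omega> \<rho> \<epsilon> |\<epsilon>. 0 < \<epsilon>}) \<and>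
      first_countable (info_topology A \<omega>) \<and>
      (\<forall>X. X \<subseteq> state_space A \<longrightarrow>
         subtopology (info_topology A \<omega>) X =
           topology_of_conv X (conv_restrict (info_conv A \<omega>) X) \<and>
         info_topology A \<omega> closure_of X = info_closure A \<omega> X)) \<and>
     ((\<Union>F \<in> {F. F face_of state_space A \<and> F \<noteq> {}}. rel_interior F) = state_space A \<and>
      disjoint_family_on rel_interior {F. F face_of state_space A \<and> F \<noteq> {}} \<and>
      (\<forall>F. F face_of state_space A \<and> F \<noteq> {} \<longrightarrow>
         rel_interior F \<in> connected_components_of (info_topology A kind_I)) \<and>
      (\<forall>F. F face_of state_space A \<longrightarrow>
         conv_restrict (info_conv A kind_I) (rel_interior F) =
           conv_restrict (norm_conv A) (rel_interior F) \<and>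
         subtopology (info_topology A kind_I) (rel_interior F) =
           subtopology (norm_topology A) (rel_interior F))) \<and>
     (topology_le (norm_topology A) (info_topology A kind_rI) \<and>
      topology_le (info_topology A kind_rI) (info_topology A kind_I) \<and>
      info_conv A kind_rI \<subseteq> norm_conv A \<and>
      info_conv A kind_I \<subseteq> info_conv A kind_rI) \<and>
     (info_topology A kind_rI closure_of rel_interior (state_space A) = state_space A \<and>
      connected_space (info_topology A kind_rI))"
proof -
  note A = subspace_cstar_subalgebra[OF assms]
  have div: "divergence (state_space A) (info_div \<omega>)" by (rule divergence_info_div)
  interpret divergence "state_space A" "info_div \<omega>" by (rule div)
  have T: "info_topology A \<omega> = T" and conv: "info_conv A \<omega> = C"
    by (simp_all add: info_topology_def info_conv_eq)
  have closure: "info_closure A \<omega> X = {\<rho> \<in> state_space A. (INF \<tau>\<in>X. info_div \<omega> \<rho> \<tau>) = 0}" for X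
    by (simp add: info_closure_def)
  have disks: "open_disk A \<omega> \<rho> \<epsilon> = {\<sigma> \<in> state_space A. info_div \<omega> \<rho> \<sigma> < \<epsilon>}"
    "closed_disk A \<omega> \<rho> \<epsilon> = {\<sigma> \<in> state_space A. info_div \<omega> \<rho> \<sigma> \<le> \<epsilon>}" for \<rho> \<epsilon>
    by (simp_all add: open_disk_def closed_disk_def)
  have le_norm: "topology_le (norm_topology A) (info_topology A \<omega>')" for \<omega>'
    unfolding norm_topology_eq info_topology_def
    by (rule topology_le_of_conv[OF info_conv_subset_norm_conv])
  have rI_le_I: "topology_le (info_topology A kind_rI) (info_topology A kind_I)"
    unfolding info_topology_def by (rule topology_le_of_conv[OF info_conv_I_subset_rI])
  have Hausdorff: "Hausdorff_space (info_topology A \<omega>)"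
    by (rule Hausdorff_space_finer[OF _ le_norm])
      (simp_all add: T norm_topology_def Hausdorff_space_subtopology)
  have Lstar: "Lstar_conv (state_space A) (info_conv A \<omega>)"
    and conv_T: "conv_of_topology (info_topology A \<omega>) = info_conv A \<omega>"
    and unique: "unique_limits (info_conv A \<omega>)"
    and first_countable: "first_countable (info_topology A \<omega>)"
    unfolding T conv
    by (rule Lstar_C conv_of_topology_T unique_limits_C first_countable_T)+
  have closures: "\<forall>X. X \<subseteq> state_space A \<longrightarrow>
         seq_closure (state_space A) (info_conv A \<omega>) X = info_closure A \<omega> X \<and>
         info_closure A \<omega> X =
           {\<rho> \<in> state_space A. \<exists>\<rho>s \<in> UNIV \<rightarrow> X. (\<lambda>i::nat. info_div \<omega> \<rho> (\<rho>s i)) \<longlonglongrightarrow> 0} \<and>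
         info_closure A \<omega> X =
           {\<rho> \<in> state_space A. \<exists>\<rho>s \<in> UNIV \<rightarrow> X. (INF i::nat. info_div \<omega> \<rho> (\<rho>s i)) = 0}"
  proof (intro allI impI conjI)
    fix X assume X: "X \<subseteq> state_space A"
    show lim: "info_closure A \<omega> X =
        {\<rho> \<in> state_space A. \<exists>\<rho>s \<in> UNIV \<rightarrow> X. (\<lambda>i::nat. info_div \<omega> \<rho> (\<rho>s i)) \<longlonglongrightarrow> 0}"
      unfolding closure using INF_eq_0_iff_sequence(1)[OF X] by blast
    show "info_closure A \<omega> X =
        {\<rho> \<in> state_space A. \<exists>\<rho>s \<in> UNIV \<rightarrow> X. (INF i::nat. info_div \<omega> \<rho> (\<rho>s i)) = 0}"
      unfolding closure using INF_eq_0_iff_sequence(2)[OF X] by blast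
    show "seq_closure (state_space A) (info_conv A \<omega>) X = info_closure A \<omega> X"
      unfolding lim using X by (auto simp: seq_closure_def info_conv_def)
  qed
  have disk_topology: "\<forall>\<rho> \<in> state_space A.
         conv_continuous (state_space A) (info_conv A \<omega>)
           {0..\<infinity>} (conv_of_topology ext_topology) (info_div \<omega> \<rho>) \<and>
         continuous_map (info_topology A \<omega>) ext_topology (info_div \<omega> \<rho>) \<and>
         (\<forall>\<epsilon>>0. openin (info_topology A \<omega>) (open_disk A \<omega> \<rho> \<epsilon>) \<and>
                closedin (info_topology A \<omega>) (closed_disk A \<omega> \<rho> \<epsilon>)) \<and>
         base_at (info_topology A \<omega>) \<rho> {open_disk A \<omega> \<rho> \<epsilon> |\<epsilon>. 0 < \<epsilon>}"
    unfolding T conv disks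
    by (intro ballI conjI allI impI conv_continuous_D continuous_map_D openin_T_disk
        closedin_T_disk base_at_disks)
  have subspaces: "\<forall>X. X \<subseteq> state_space A \<longrightarrow>
         subtopology (info_topology A \<omega>) X =
           topology_of_conv X (conv_restrict (info_conv A \<omega>) X) \<and>
         info_topology A \<omega> closure_of X = info_closure A \<omega> X"
    unfolding T conv closure using subtopology_T closure_of_T by blast
  have components: "\<forall>F. F face_of state_space A \<and> F \<noteq> {} \<longrightarrow>
      rel_interior F \<in> connected_components_of (info_topology A kind_I)"
    using rel_interior_face_component[OF A] by blast
  have faces: "\<forall>F. F face_of state_space A \<longrightarrow>
         conv_restrict (info_conv A kind_I) (rel_interior F) =
           conv_restrict (norm_conv A) (rel_interior F) \<and>
         subtopology (info_topology A kind_I) (rel_interior F) =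
           subtopology (norm_topology A) (rel_interior F)"
    using conv_restrict_rel_interior_face[OF A] subtopology_rel_interior_face[OF A] by blast
  show ?thesis
    by (intro conjI Lstar conv_T closures unique info_conv_subset_norm_conv le_norm Hausdorff
        disk_topology first_countable subspaces UN_rel_interior_faces[OF A]
        disjoint_rel_interior_faces[OF A] components faces rI_le_I info_conv_I_subset_rI
        closure_of_rel_interior_state_space[OF A] connected_space_rI[OF A])
qed

end
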